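(* Let $X$ be a mixed-stable sequence with respect to a full BST $T$, and assume $X$ is a whole multiple of its atomic sequence. Then $$\mathrm{cost}(GF,X,T)<\tfrac52\cdot\mathrm{cost}(OPT,X,T).$$ If $X$ is strongly-stable, then $\mathrm{cost}(GF,X,T)<2\cdot\mathrm{cost}(OPT,X,T)$.
   Context: Binary search tree model. Keys are $\{1,\dots,n\}$. A query sequence is $X=[x_1,\dots,x_m]$, and $T_0$ is an initial BST. An algorithm $A$ serves $x_1,\dots,x_m$ in order. Before serving $x_t$ it holds a BST $T_{t-1}$; it searches $x_t$ from the root and may then restructure the tree by rotations into $T_t$. Let $P_t$ be the set of nodes on the root-to-$x_t$ path of $T_{t-1}$, and let $U_t$ be the node set of the minimal subtree containing all edges rotated in transforming $T_{t-1}$ into $T_t$. The cost at time $t$ is $|P_t\cup U_t|$, and $\mathrm{cost}(A,X,T_0)$ is the sum of these costs. $OPT$ denotes an algorithm of minimum cost on $(X,T_0)$ that knows all of $X$ in advance. Greedy Future ($GF$). After finding $x_t$ in $T_{t-1}$, let $v_1<\dots<v_k$ be the keys on the root-to-$x_t$ path, set $v_0=-\infty$ and $v_{k+1}=+\infty$, and let $R_0,\dots,R_k$ be the subtrees hanging off this path. For each $i$, $\tau(v_i)$ is the smallest $s>t$ with $x_s\in(v_{i-1},v_{i+1})$, or $+\infty$ if there is none. $GF$ rearranges $v_1,\dots,v_k$ as a treap: a BST in key order and a heap in $\tau$, with the smallest $\tau$ at the top. Ties in $\tau$ are broken in favor of the node of smaller depth in $T_{t-1}$. It then reattaches $R_0,\dots,R_k$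 unchanged at their unique positions, giving $T_t$. Stable sequences. Let $T$ be a full binary search tree (every inner node has exactly two children), and let $X$ be a query sequence consisting only of keys stored at leaves of $T$. For an inner node $v$, let $X_v$ be the subsequence of $X$ consisting of the queries to keys in the subtree of $v$. - The node $v$ is strongly-stable if consecutive queries of $X_v$ alternate between the left and right subtrees of $v$. - The node $v$ is weakly-stable with a left bias if its left child $u$ is an inner node and $X_v$ repeats cyclically (from some starting phase) the pattern: a query in the left subtree of $u$, then one in the right subtree of $u$, then one in the right subtree of $v$. - Weakly-stable with a right bias is the mirror image: $u$ is the right child of $v$, and the pattern is right subtree of $u$, left subtree of $u$, left subtree of $v$. In both weakly-stable cases $u$ is called the favored child of $v$. $X$ (and $T$) is mixed-stable if every inner node of $T$ is strongly-stable or weakly-stable, and strongly-stable if every inner node is strongly-stable. The atomic sequence is the shortest such stable sequence all of whose repetitions are again such stable sequences. $X$ is a whole multiple of it if it is a concatenation of copies of it. *)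

theory Defs
  imports Complex_Main "HOL-Library.Tree"
begin

(* Keys are natural numbers; BSTs are values of type nat tree (HOL-Library.Tree),
   a node being Node l k r and Leaf the empty tree. *)

section \<open>Basic BST notions\<close>

fun full :: "'a tree \<Rightarrow> bool" where
  "full Leaf = True"
| "full (Node l a r) = ((l = Leaf \<longleftrightarrow> r = Leaf) \<and> full l \<and> full r)"

text \<open>Keys stored at leaves (nodes without children) and inner nodes.\<close>
definition leaf_key :: "nat tree \<Rightarrow> nat \<Rightarrow> bool" where
  "leaf_key T x \<longleftrightarrow> Node Leaf x Leaf \<in> subtrees T"

text \<open>Set of keys on the root-to-x search path.\<close>
fun path_keys :: "nat \<Rightarrow> nat tree \<Rightarrow> nat set" where
  "path_keys x Leaf = {}"
| "path_keys x (Node l a r) =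
     insert a (if x < a then path_keys x l else if a < x then path_keys x r else {})"

text \<open>Parent-child edges of a tree, as (parent key, child key).\<close>
fun tree_edges :: "nat tree \<Rightarrow> (nat \<times> nat) set" where
  "tree_edges Leaf = {}"
| "tree_edges (Node l a r) = tree_edges l \<union> tree_edges r
     \<union> (if l = Leaf then {} else {(a, value l)})
     \<union> (if r = Leaf then {} else {(a, value r)})"

text \<open>A node set S is connected (forms a subtree) in T.\<close>
definition connected_in :: "nat tree \<Rightarrow> nat set \<Rightarrow> bool" where
  "connected_in T S \<longleftrightarrow> S \<subseteq> set_tree T \<and>
     (\<forall>u\<in>S. \<forall>v\<in>S. (u, v) \<in> ({(a, b). ((a, b) \<in> tree_edges T \<or> (b, a) \<in> tree_edges T)
                                          \<and> a \<in> S \<and> b \<in> S})\<^sup>*)"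

text \<open>Node set of the minimal subtree of T containing all nodes of E.\<close>
definition steiner :: "nat tree \<Rightarrow> nat set \<Rightarrow> nat set" where
  "steiner T E = \<Inter> {S. E \<subseteq> S \<and> connected_in T S}"

section \<open>Rotations\<close>

text \<open>A single rotation of the edge (parent, child).\<close>
inductive rot_step :: "nat tree \<Rightarrow> nat \<times> nat \<Rightarrow> nat tree \<Rightarrow> bool" where
  rot_right: "rot_step (Node (Node a x b) y c) (y, x) (Node a x (Node b y c))"
| rot_left: "rot_step (Node a x (Node b y c)) (x, y) (Node (Node a x b) y c)"
| rot_in_left: "rot_step l e l' \<Longrightarrow> rot_step (Node l v r) e (Node l' v r)"
| rot_in_right: "rot_step r e r' \<Longrightarrow> rot_step (Node l v r) e (Node l v r')"

text \<open>A sequence of rotations (edges listed in order) transforming one tree into another.\<close>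
inductive rots :: "nat tree \<Rightarrow> (nat \<times> nat) list \<Rightarrow> nat tree \<Rightarrow> bool" where
  rots_nil: "rots T [] T"
| rots_cons: "rot_step T e T1 \<Longrightarrow> rots T1 es T2 \<Longrightarrow> rots T (e # es) T2"

definition endpoints :: "(nat \<times> nat) list \<Rightarrow> nat set" where
  "endpoints es = fst ` set es \<union> snd ` set es"

text \<open>Cost of one step: serve x in T, then restructure T by rotations es.
  P = search path in T, U = nodes of minimal subtree of T containing the rotated edges.\<close>
definition step_cost :: "nat tree \<Rightarrow> nat \<Rightarrow> (nat \<times> nat) list \<Rightarrow> nat" where
  "step_cost T x es = card (path_keys x T \<union> steiner T (endpoints es))"

text \<open>Cost of a run given trees Tr 0 = T0, Tr 1, ..., Tr m and rotation sequences es t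
  transforming Tr t into Tr (t+1); the query served at step t (0-based) is X ! t.\<close>
definition run_cost :: "nat list \<Rightarrow> (nat \<Rightarrow> nat tree) \<Rightarrow> (nat \<Rightarrow> (nat \<times> nat) list) \<Rightarrow> nat" where
  "run_cost X Tr es = (\<Sum>t<length X. step_cost (Tr t) (X ! t) (es t))"

definition valid_run :: "nat list \<Rightarrow> nat tree \<Rightarrow> (nat \<Rightarrow> nat tree) \<Rightarrow> (nat \<Rightarrow> (nat \<times> nat) list) \<Rightarrow> bool" where
  "valid_run X T0 Tr es \<longleftrightarrow> Tr 0 = T0 \<and> (\<forall>t<length X. rots (Tr t) (es t) (Tr (Suc t)))"

text \<open>OPT: minimum cost over all (offline) algorithms.\<close>
definition opt_cost :: "nat list \<Rightarrow> nat tree \<Rightarrow> nat" where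
  "opt_cost X T0 = (LEAST c. \<exists>Tr es. valid_run X T0 Tr es \<and> c = run_cost X Tr es)"

section \<open>Greedy Future\<close>

text \<open>Decompose T along the search path to x (depth d of the current root):
  the path keys in increasing order paired with their depths, and the hanging
  subtrees R_0, ..., R_k.\<close>
fun decomp :: "nat \<Rightarrow> nat tree \<Rightarrow> nat \<Rightarrow> (nat \<times> nat) list \<times> nat tree list" where
  "decomp x Leaf d = ([], [Leaf])"
| "decomp x (Node l a r) d =
    (if x < a then (let (vs, rs) = decomp x l (Suc d) in (vs @ [(a, d)], rs @ [r]))
     else if a < x then (let (vs, rs) = decomp x r (Suc d) in ((a, d) # vs, l # rs))
     else ([(a, d)], [l, r]))"

text \<open>Index of the element of minimal priority (lexicographic on (tau, depth)).\<close>
definition argmin_idx :: "(nat \<times> nat) list \<Rightarrow> nat" where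
  "argmin_idx ps = (LEAST j. j < length ps \<and> (\<forall>i<length ps. fst (ps ! j) < fst (ps ! i) \<or>
        (fst (ps ! j) = fst (ps ! i) \<and> snd (ps ! j) \<le> snd (ps ! i))))"

text \<open>Build the treap: vs = keys in increasing order with priorities, rs = hanging subtrees
  (length vs + 1 of them).\<close>
function build :: "(nat \<times> (nat \<times> nat)) list \<Rightarrow> nat tree list \<Rightarrow> nat tree" where
  "build vs rs =
    (if vs = [] then hd rs
     else (let j = min (argmin_idx (map snd vs)) (length vs - 1) in
       Node (build (take j vs) (take (Suc j) rs)) (fst (vs ! j))
            (build (drop (Suc j) vs) (drop (Suc j) rs))))"
  by pat_completeness auto
termination
proof (relation "measure (\<lambda>(vs, rs). length vs)")
  fix vs :: "(nat \<times> (nat \<times> nat)) list" and rs :: "nat tree list" and j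
  assume "vs \<noteq> []" "j = min (argmin_idx (map snd vs)) (length vs - 1)"
  show "((take j vs, take (Suc j) rs), vs, rs) \<in> measure (\<lambda>(vs, rs). length vs)"
    using \<open>vs \<noteq> []\<close> \<open>j = _\<close> by (simp add: min_less_iff_disj)
next
  fix vs :: "(nat \<times> (nat \<times> nat)) list" and rs :: "nat tree list" and j
  assume "vs \<noteq> []" "j = min (argmin_idx (map snd vs)) (length vs - 1)"
  show "((drop (Suc j) vs, drop (Suc j) rs), vs, rs) \<in> measure (\<lambda>(vs, rs). length vs)"
    using \<open>vs \<noteq> []\<close> by auto
qed auto

text \<open>Open interval (lo, hi) with None standing for -infinity / +infinity.\<close>
definition in_interval :: "nat option \<Rightarrow> nat option \<Rightarrow> nat \<Rightarrow> bool" where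
  "in_interval lo hi y \<longleftrightarrow> (case lo of None \<Rightarrow> True | Some a \<Rightarrow> a < y)
                          \<and> (case hi of None \<Rightarrow> True | Some b \<Rightarrow> y < b)"

text \<open>tau at (0-based) time t: smallest s > t with X ! s in the interval; length X
  encodes +infinity (all real times are < length X).\<close>
definition next_time :: "nat list \<Rightarrow> nat \<Rightarrow> nat option \<Rightarrow> nat option \<Rightarrow> nat" where
  "next_time X t lo hi =
     (if \<exists>s. t < s \<and> s < length X \<and> in_interval lo hi (X ! s)
      then (LEAST s. t < s \<and> s < length X \<and> in_interval lo hi (X ! s))
      else length X)"

text \<open>One GF step at (0-based) time t with query X ! t on tree T.\<close>
definition gf_step :: "nat list \<Rightarrow> nat \<Rightarrow> nat tree \<Rightarrow> nat tree" where
  "gf_step X t T =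
    (let (vd, rs) = decomp (X ! t) T 0;
         k = length vd;
         key = (\<lambda>i. fst (vd ! i));
         lo = (\<lambda>i. if i = 0 then None else Some (key (i - 1)));
         hi = (\<lambda>i. if Suc i = k then None else Some (key (Suc i)));
         vs = map (\<lambda>i. (key i, (next_time X t (lo i) (hi i), snd (vd ! i)))) [0..<k]
     in build vs rs)"

text \<open>Tree held by GF before serving query t (0-based).\<close>
primrec gf_tree :: "nat list \<Rightarrow> nat tree \<Rightarrow> nat \<Rightarrow> nat tree" where
  "gf_tree X T0 0 = T0"
| "gf_tree X T0 (Suc t) = gf_step X t (gf_tree X T0 t)"

text \<open>Cost of GF: the trees are determined by GF; the rotations realising each
  transition are chosen to minimise the cost.\<close>
definition gf_cost :: "nat list \<Rightarrow> nat tree \<Rightarrow> nat" where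
  "gf_cost X T0 = (LEAST c. \<exists>es. valid_run X T0 (gf_tree X T0) es \<and> c = run_cost X (gf_tree X T0) es)"

section \<open>Stable sequences\<close>

definition subseq_in :: "nat tree \<Rightarrow> nat list \<Rightarrow> nat list" where
  "subseq_in S X = filter (\<lambda>x. x \<in> set_tree S) X"

definition strongly_stable_node :: "nat tree \<Rightarrow> nat list \<Rightarrow> bool" where
  "strongly_stable_node v X \<longleftrightarrow>
     (let Xv = subseq_in v X in
      \<forall>i. Suc i < length Xv \<longrightarrow> (Xv ! i \<in> set_tree (left v) \<longleftrightarrow> Xv ! Suc i \<in> set_tree (right v)))"

definition cyclic3 :: "nat tree \<Rightarrow> nat tree \<Rightarrow> nat tree \<Rightarrow> nat list \<Rightarrow> bool" where
  "cyclic3 A B C Y \<longleftrightarrow> (\<exists>p<3. \<forall>i<length Y.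
      Y ! i \<in> set_tree ([A, B, C] ! ((i + p) mod 3)))"

definition weakly_stable_left :: "nat tree \<Rightarrow> nat list \<Rightarrow> bool" where
  "weakly_stable_left v X \<longleftrightarrow> (let u = left v in
     u \<noteq> Leaf \<and> left u \<noteq> Leaf \<and>
     cyclic3 (left u) (right u) (right v) (subseq_in v X))"

definition weakly_stable_right :: "nat tree \<Rightarrow> nat list \<Rightarrow> bool" where
  "weakly_stable_right v X \<longleftrightarrow> (let u = right v in
     u \<noteq> Leaf \<and> left u \<noteq> Leaf \<and>
     cyclic3 (right u) (left u) (left v) (subseq_in v X))"

definition inner_nodes :: "nat tree \<Rightarrow> nat tree set" where
  "inner_nodes T = {v \<in> subtrees T. v \<noteq> Leaf \<and> left v \<noteq> Leaf}"

definition leaf_queries :: "nat tree \<Rightarrow> nat list \<Rightarrow> bool" where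
  "leaf_queries T X \<longleftrightarrow> (\<forall>x\<in>set X. leaf_key T x)"

definition mixed_stable :: "nat tree \<Rightarrow> nat list \<Rightarrow> bool" where
  "mixed_stable T X \<longleftrightarrow> full T \<and> leaf_queries T X \<and>
     (\<forall>v\<in>inner_nodes T. strongly_stable_node v X \<or> weakly_stable_left v X \<or> weakly_stable_right v X)"

definition strongly_stable :: "nat tree \<Rightarrow> nat list \<Rightarrow> bool" where
  "strongly_stable T X \<longleftrightarrow> full T \<and> leaf_queries T X \<and>
     (\<forall>v\<in>inner_nodes T. strongly_stable_node v X)"

definition repeat :: "nat \<Rightarrow> nat list \<Rightarrow> nat list" where
  "repeat k A = concat (replicate k A)"

text \<open>A is the atomic sequence of X w.r.t. a stability notion stab: the shortest nonempty
  sequence generating X (X is a prefix, via take, of a repetition of it) all of whose repetitions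
  are stable.\<close>
definition atomic_seq :: "(nat tree \<Rightarrow> nat list \<Rightarrow> bool) \<Rightarrow> nat tree \<Rightarrow> nat list \<Rightarrow> nat list \<Rightarrow> bool" where
  "atomic_seq stab T X A \<longleftrightarrow>
     (let good = (\<lambda>B. B \<noteq> [] \<and> (\<forall>j\<ge>1. stab T (repeat j B)) \<and> (\<exists>j. take (length X) (repeat j B) = X))
      in good A \<and> (\<forall>B. good B \<longrightarrow> length A \<le> length B))"

end

theory Submission
  imports Defs
begin

text \<open>Stability makes the priority of every node on the search path equal to the time of the next
  query in its subtree, so the treap order is the old path order: Greedy Future never changes
  \<open>T\<close>, and its cost is \<open>m + (\<Sum>v. |X\<^sub>v|)\<close> for \<open>m\<close> queries, with \<open>v\<close> ranging over inner nodes.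

  The optimum is bounded below by Wilber's interleave argument with \<open>T\<close> as reference tree: for
  every inner node \<open>v\<close>, any algorithm touches the current transition point of \<open>v\<close> whenever the
  queries pass from one side of \<open>v\<close> to the other, and different nodes have different transition
  points, none of them the root. A strongly stable node thus charges one touch per two queries,
  and a weakly stable node together with its favored child two touches per five queries, whence
  the factors 2 and 5/2; the \<open>m\<close> touches of the root make the inequalities strict.\<close>

section \<open>Search paths\<close>

text \<open>Greedy Future ranks a path key by the next query between its two neighbours on the path.
  That interval may be only part of the subtree of the key, so the agreement of the two next-query
  times needs an argument. After a query on one side of \<open>v\<close>, the whole other side of
  \<open>v\<close> is still inside the interval. Consecutive queries on the same side of
  \<open>v\<close> occur only in a weak pattern, and there its direction is decisive: the passage
  from the outer to the inner subtree of the favored child stays inside the interval, the reverse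
  passage would not. An ancestor and a descendant may share their next query; such ties are settled
  by depth, hence in favor of the old tree. Whole multiples enter through \<open>X @ X\<close>,
  which must be stable too: an incomplete period at a node would cost Greedy Future its queries
  without forcing the corresponding touch. In the strong case the atomic sequence is still the one
  for mixed stability, so odd counts survive and are bounded by a separate count of branching
  nodes.\<close>

lemma path_keys_subset: "path_keys x S \<subseteq> set_tree S"
  by (induction S) auto

lemma bst_disjoint: "bst (Node l a r) \<Longrightarrow> set_tree l \<inter> set_tree r = {}"
  by (auto dest: order.strict_trans)

lemma path_keys_antisym:
  "bst S \<Longrightarrow> z \<in> path_keys w S \<Longrightarrow> w \<in> path_keys z S \<Longrightarrow> z = w"
proof (induction S)
  case (Node l a r)
  have "u < a" if "u \<in> path_keys y l" for u y
    using that path_keys_subset[of y l] Node.prems(1) by auto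
  moreover have "a < u" if "u \<in> path_keys y r" for u y
    using that path_keys_subset[of y r] Node.prems(1) by auto
  ultimately have "z = w \<or> z \<in> path_keys w l \<and> w \<in> path_keys z l \<or>
      z \<in> path_keys w r \<and> w \<in> path_keys z r"
    using Node.prems(2,3) by (auto split: if_splits)
  then show ?case using Node by auto
qed simp

lemma path_keys_trans:
  "bst S \<Longrightarrow> a \<in> path_keys b S \<Longrightarrow> b \<in> path_keys y S \<Longrightarrow> a \<in> path_keys y S"
proof (induction S)
  case (Node l k r)
  have "b < k" if "b \<in> path_keys y l"
    using that path_keys_subset[of y l] Node.prems(1) by auto
  moreover have "k < b" if "b \<in> path_keys y r"
    using that path_keys_subset[of y r] Node.prems(1) by auto
  ultimately show ?case
    using Node by (cases y k rule: linorder_cases) (auto split: if_splits)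
qed simp

lemma set_tree_subtrees: "v \<in> subtrees T \<Longrightarrow> set_tree v \<subseteq> set_tree T"
  by (induction T) auto

lemma bst_subtrees: "v \<in> subtrees T \<Longrightarrow> bst T \<Longrightarrow> bst v"
  by (induction T) auto

lemma subtrees_refl: "T \<in> subtrees T"
  by (cases T) auto

lemma subtrees_trans: "u \<in> subtrees v \<Longrightarrow> v \<in> subtrees T \<Longrightarrow> u \<in> subtrees T"
  by (induction T) auto

lemma full_subtrees: "v \<in> subtrees T \<Longrightarrow> full T \<Longrightarrow> full v"
  by (induction T) auto

text \<open>The descendants of the key \<open>z\<close>, expressed through search paths instead of
  subtrees, so that trees of different shape over the same keys can be compared. Empty if
  \<open>z\<close> does not occur.\<close>

definition keys_below :: "nat tree \<Rightarrow> nat \<Rightarrow> nat set" where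
  "keys_below S z = {x \<in> set_tree S. z \<in> path_keys x S}"

text \<open>Path keys outside \<open>v\<close> belong to proper ancestors of its root, and the key
  of such an ancestor lies outside the key range of \<open>v\<close>.\<close>

lemma path_keys_subtree:
  assumes "bst T" "v \<in> subtrees T" "x \<in> set_tree v" "w \<in> path_keys x T"
  shows "w \<in> path_keys x v \<or> (\<forall>y\<in>set_tree v. w < y) \<or> (\<forall>y\<in>set_tree v. y < w)"
  using assms
proof (induction T)
  case (Node l b r)
  consider "v = Node l b r" | "v \<in> subtrees l" | "v \<in> subtrees r"
    using Node.prems by auto
  then show ?case
  proof cases
    case 2
    then have "set_tree v \<subseteq> set_tree l" by (rule set_tree_subtrees)
    with Node.prems(1) have lt: "\<forall>y\<in>set_tree v. y < b" by auto
    then have "x < b" using Node.prems(3) by blast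
    then have "w = b \<or> w \<in> path_keys x l" using Node.prems(4) by auto
    with lt 2 Node.IH(1) Node.prems show ?thesis by auto
  next
    case 3
    then have "set_tree v \<subseteq> set_tree r" by (rule set_tree_subtrees)
    with Node.prems(1) have lt: "\<forall>y\<in>set_tree v. b < y" by auto
    then have "b < x" using Node.prems(3) by blast
    then have "w = b \<or> w \<in> path_keys x r" using Node.prems(4) by auto
    with lt 3 Node.IH(2) Node.prems show ?thesis by auto
  qed (use Node in simp)
qed auto

lemma keys_below_value:
  assumes "bst T" "v \<in> subtrees T" "v \<noteq> Leaf"
  shows "keys_below T (value v) = set_tree v"
  using assms
proof (induction T)
  case (Node l b r)
  consider "v = Node l b r" | "v \<in> subtrees l" | "v \<in> subtrees r"
    using Node.prems by auto
  then show ?case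
  proof cases
    case 2
    then have "value v \<in> set_tree l"
      using set_tree_subtrees[OF 2] Node.prems(3) by (cases v) auto
    moreover have "set_tree v \<subseteq> set_tree l" using 2 by (rule set_tree_subtrees)
    moreover have "keys_below l (value v) = set_tree v" using Node 2 by simp
    moreover have "keys_below (Node l b r) (value v) = keys_below l (value v)"
      if "value v \<in> set_tree l"
    proof -
      have "value v < b" "value v \<notin> set_tree r"
        using that Node.prems(1) by (auto dest: order.strict_trans)
      then have "value v \<notin> path_keys x r" "value v \<noteq> b" for x
        using path_keys_subset[of x r] by auto
      then show ?thesis
        using Node.prems(1) by (auto simp: keys_below_def split: if_splits)
    qed
    ultimately show ?thesis by simp
  next
    case 3
    then have "value v \<in> set_tree r"
      using set_tree_subtrees[OF 3] Node.prems(3) by (cases v) auto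
    moreover have "set_tree v \<subseteq> set_tree r" using 3 by (rule set_tree_subtrees)
    moreover have "keys_below r (value v) = set_tree v" using Node 3 by simp
    moreover have "keys_below (Node l b r) (value v) = keys_below r (value v)"
      if "value v \<in> set_tree r"
    proof -
      have "b < value v" "value v \<notin> set_tree l"
        using that Node.prems(1) by (auto dest: order.strict_trans)
      then have "value v \<notin> path_keys x l" "value v \<noteq> b" for x
        using path_keys_subset[of x l] by auto
      then show ?thesis
        using Node.prems(1)
        by (auto simp: keys_below_def dest: order.strict_trans split: if_splits)
    qed
    ultimately show ?thesis by simp
  qed (auto simp: keys_below_def)
qed simp

lemma path_key_is_value:
  "a \<in> path_keys x T \<Longrightarrow> \<exists>v\<in>subtrees T. v \<noteq> Leaf \<and> value v = a"
proof (induction T)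
  case (Node l b r)
  then show ?case by (force split: if_splits)
qed simp

section \<open>Transition points\<close>

text \<open>For adjacent key intervals \<open>L\<close> and \<open>R\<close>, the topmost key of \<open>L \<union> R\<close> lies in one of
  them; the transition point is the topmost key of the other. Phrased through \<open>keys_below\<close>,
  it is visibly unaffected by rotations that do not involve it.\<close>

definition transition :: "nat tree \<Rightarrow> nat set \<Rightarrow> nat set \<Rightarrow> nat \<Rightarrow> bool" where
  "transition S L R z \<longleftrightarrow>
     z \<in> R \<and> R \<subseteq> keys_below S z \<and> \<not> L \<subseteq> keys_below S z \<or>
     z \<in> L \<and> L \<subseteq> keys_below S z \<and> \<not> R \<subseteq> keys_below S z"

definition convex_in :: "nat set \<Rightarrow> nat set \<Rightarrow> bool" where
  "convex_in K I \<longleftrightarrow> I \<subseteq> K \<and> (\<forall>x\<in>I. \<forall>y\<in>I. \<forall>k\<in>K. x \<le> k \<longrightarrow> k \<le> y \<longrightarrow> k \<in> I)"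

lemma convex_in_subset: "convex_in K I \<Longrightarrow> K' \<subseteq> K \<Longrightarrow> I \<subseteq> K' \<Longrightarrow> convex_in K' I"
  unfolding convex_in_def by blast

text \<open>Descend from the root: if two keys of \<open>I\<close> lie on different sides of the
  root, the root is between them and convexity puts it into \<open>I\<close>; otherwise
  \<open>I\<close> lies within one child.\<close>

lemma convex_in_topmost:
  assumes "bst S" "convex_in (set_tree S) I" "I \<noteq> {}"
  shows "\<exists>z\<in>I. I \<subseteq> keys_below S z"
  using assms
proof (induction S)
  case (Node l a r)
  have I: "I \<subseteq> insert a (set_tree l \<union> set_tree r)"
    using Node.prems(2) unfolding convex_in_def by auto
  consider "a \<in> I" | "a \<notin> I" "I \<subseteq> set_tree l" | "a \<notin> I" "I \<subseteq> set_tree r"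
  proof (cases "a \<in> I")
    case False
    have "I \<subseteq> set_tree l \<or> I \<subseteq> set_tree r"
    proof (rule ccontr)
      assume "\<not> ?thesis"
      then obtain x y where xy: "x \<in> I" "y \<in> I" "x \<notin> set_tree r" "y \<notin> set_tree l" by auto
      with I False have "x \<in> set_tree l" "y \<in> set_tree r" by auto
      then have "x \<le> a" "a \<le> y" using Node.prems(1) by (auto intro: less_imp_le)
      moreover have "a \<in> set_tree (Node l a r)" by simp
      ultimately have "a \<in> I" using xy(1,2) Node.prems(2) unfolding convex_in_def by blast
      with False show False by simp
    qed
    with False that show thesis by blast
  qed blast
  then show ?case
  proof cases
    case 1
    then show ?thesis using I by (auto simp: keys_below_def)
  next
    case 2
    then have "convex_in (set_tree l) I"
      by (intro convex_in_subset[OF Node.prems(2)]) auto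
    then obtain z where "z \<in> I" "I \<subseteq> keys_below l z"
      using Node.IH(1) Node.prems(1,3) by auto
    moreover have "keys_below l z \<subseteq> keys_below (Node l a r) z"
      using Node.prems(1) by (auto simp: keys_below_def)
    ultimately show ?thesis by blast
  next
    case 3
    then have "convex_in (set_tree r) I"
      by (intro convex_in_subset[OF Node.prems(2)]) auto
    then obtain z where "z \<in> I" "I \<subseteq> keys_below r z"
      using Node.IH(2) Node.prems(1,3) by auto
    moreover have "keys_below r z \<subseteq> keys_below (Node l a r) z"
      using Node.prems(1) by (auto simp: keys_below_def dest: order.strict_trans)
    ultimately show ?thesis by blast
  qed
qed (simp add: convex_in_def)

lemma keys_below_antisym:
  "bst S \<Longrightarrow> z \<in> keys_below S w \<Longrightarrow> w \<in> keys_below S z \<Longrightarrow> z = w"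
  using path_keys_antisym by (auto simp: keys_below_def)

text \<open>The topmost key \<open>m\<close> of the union coincides with the topmost key of the side
  it lies in, and the topmost key of the other side is the transition point. For uniqueness, two
  candidates on one side are descendants of each other, while of two candidates on different sides
  one would be \<open>m\<close>, which has both sides below it.\<close>

lemma transition_ex1:
  assumes "bst S" "convex_in (set_tree S) L" "convex_in (set_tree S) R"
    "convex_in (set_tree S) (L \<union> R)" "L \<noteq> {}" "R \<noteq> {}" "L \<inter> R = {}"
  shows "\<exists>!z. transition S L R z"
proof -
  note anti = keys_below_antisym[OF assms(1)]
  obtain l where l: "l \<in> L" "L \<subseteq> keys_below S l"
    using convex_in_topmost[OF assms(1,2)] assms by auto
  obtain r where r: "r \<in> R" "R \<subseteq> keys_below S r"
    using convex_in_topmost[OF assms(1,3)] assms by auto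
  obtain m where m: "m \<in> L \<union> R" "L \<union> R \<subseteq> keys_below S m"
    using convex_in_topmost[OF assms(1,4)] assms by auto
  have ex: "\<exists>z. transition S L R z"
  proof (cases "m \<in> L")
    case True
    have "\<not> L \<subseteq> keys_below S r"
    proof
      assume "L \<subseteq> keys_below S r"
      then have "m = r" using anti[of m r] True r m by auto
      then show False using True r assms(7) by auto
    qed
    with r show ?thesis by (auto simp: transition_def)
  next
    case False
    have "\<not> R \<subseteq> keys_below S l"
    proof
      assume "R \<subseteq> keys_below S l"
      then have "m = l" using anti[of m l] False l m by auto
      then show False using False l by auto
    qed
    with l show ?thesis by (auto simp: transition_def)
  qed
  have "z = z'" if "transition S L R z" "transition S L R z'" for z z'
    using that unfolding transition_def
  proof (elim disjE conjE)
    assume a: "z \<in> R" "R \<subseteq> keys_below S z" "\<not> L \<subseteq> keys_below S z"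
      "z' \<in> L" "L \<subseteq> keys_below S z'" "\<not> R \<subseteq> keys_below S z'"
    show ?thesis using m a anti[of m z] anti[of m z'] by blast
  next
    assume a: "z' \<in> R" "R \<subseteq> keys_below S z'" "\<not> L \<subseteq> keys_below S z'"
      "z \<in> L" "L \<subseteq> keys_below S z" "\<not> R \<subseteq> keys_below S z"
    show ?thesis using m a anti[of m z] anti[of m z'] by blast
  qed (use anti[of z z'] in blast)+
  with ex show ?thesis by blast
qed

text \<open>The root has all keys below it, whereas a transition point misses part of one
  side.\<close>

lemma transition_not_root:
  assumes "transition (Node l a r) L R z" "L \<union> R \<subseteq> set_tree (Node l a r)"
  shows "z \<noteq> a"
  using assms by (auto simp: transition_def keys_below_def)

lemma transition_cong:
  assumes "transition S L R z" "keys_below S' z = keys_below S z"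
  shows "transition S' L R z"
  using assms by (simp add: transition_def)

section \<open>Rotations\<close>

text \<open>A rotation changes the set of descendants only for the two ends of the rotated edge;
  every other node keeps the same keys below it.\<close>

lemma rot_step_invariants:
  assumes "rot_step S e S'" "bst S"
  shows "bst S' \<and> set_tree S' = set_tree S \<and> fst e \<in> set_tree S \<and> snd e \<in> set_tree S \<and>
    (\<forall>x z. z \<noteq> fst e \<longrightarrow> z \<noteq> snd e \<longrightarrow> z \<in> path_keys x S \<longleftrightarrow> z \<in> path_keys x S')"
  using assms
proof (induction rule: rot_step.induct)
  case (rot_right a x b y c)
  then have "x < y" by simp
  then have "z \<in> path_keys k (Node (Node a x b) y c) \<longleftrightarrow> z \<in> path_keys k (Node a x (Node b y c))"
    if "z \<noteq> y" "z \<noteq> x" for k z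
    using that by simp
  moreover have "bst (Node a x (Node b y c))"
    using rot_right by (auto dest: order.strict_trans)
  ultimately show ?case by (simp del: path_keys.simps) auto
next
  case (rot_left a x b y c)
  then have "x < y" by simp
  then have "z \<in> path_keys k (Node a x (Node b y c)) \<longleftrightarrow> z \<in> path_keys k (Node (Node a x b) y c)"
    if "z \<noteq> x" "z \<noteq> y" for k z
    using that by simp
  moreover have "bst (Node (Node a x b) y c)"
    using rot_left by (auto dest: order.strict_trans)
  ultimately show ?case by (simp del: path_keys.simps) auto
next
  case (rot_in_left l e l' v r)
  then show ?case by simp
next
  case (rot_in_right r e r' l v)
  then show ?case by simp
qed

lemma rots_invariants:
  assumes "rots S es S'" "bst S"
  shows "bst S' \<and> set_tree S' = set_tree S \<and> endpoints es \<subseteq> set_tree S \<and>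
    (\<forall>x z. z \<notin> endpoints es \<longrightarrow> z \<in> path_keys x S \<longleftrightarrow> z \<in> path_keys x S')"
  using assms
proof (induction rule: rots.induct)
  case (rots_cons T e T1 es T2)
  note step = rot_step_invariants[OF rots_cons.hyps(1) rots_cons.prems]
  have "endpoints (e # es) = {fst e, snd e} \<union> endpoints es" by (auto simp: endpoints_def)
  with step rots_cons.IH show ?case by auto
qed (simp add: endpoints_def)

lemma keys_below_rots:
  assumes "rots S es S'" "bst S" "z \<notin> endpoints es"
  shows "keys_below S' z = keys_below S z"
  using rots_invariants[OF assms(1,2)] assms(3) by (auto simp: keys_below_def)

section \<open>Minimal subtrees\<close>

lemma root_connected:
  "v \<in> set_tree S \<Longrightarrow> (value S, v) \<in>
    {(a, b). ((a, b) \<in> tree_edges S \<or> (b, a) \<in> tree_edges S) \<and> a \<in> set_tree S \<and> b \<in> set_tree S}\<^sup>*"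
  (is "_ \<Longrightarrow> _ \<in> (?E S)\<^sup>*")
proof (induction S)
  case (Node l a r)
  have sub: "(?E l)\<^sup>* \<subseteq> (?E (Node l a r))\<^sup>*" "(?E r)\<^sup>* \<subseteq> (?E (Node l a r))\<^sup>*"
    by (intro rtrancl_mono; auto)+
  consider "v = a" | "v \<in> set_tree l" | "v \<in> set_tree r" using Node.prems by auto
  then show ?case
  proof cases
    case 2
    then obtain l1 b l2 where "l = Node l1 b l2" by (cases l) auto
    then have "(a, value l) \<in> ?E (Node l a r)" by auto
    with 2 Node.IH(1) sub(1) show ?thesis
      by (metis (no_types, lifting) converse_rtrancl_into_rtrancl subsetD tree.sel(2))
  next
    case 3
    then obtain l1 b l2 where "r = Node l1 b l2" by (cases r) auto
    then have "(a, value r) \<in> ?E (Node l a r)" by auto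
    with 3 Node.IH(2) sub(2) show ?thesis
      by (metis (no_types, lifting) converse_rtrancl_into_rtrancl subsetD tree.sel(2))
  qed simp
qed simp

lemma connected_in_set_tree: "connected_in S (set_tree S)"
proof -
  let ?E = "{(a, b). ((a, b) \<in> tree_edges S \<or> (b, a) \<in> tree_edges S)
    \<and> a \<in> set_tree S \<and> b \<in> set_tree S}"
  have "sym (?E\<^sup>*)" by (intro sym_rtrancl) (auto simp: sym_def)
  then have "(u, v) \<in> ?E\<^sup>*" if "u \<in> set_tree S" "v \<in> set_tree S" for u v
    using root_connected[OF that(1)] root_connected[OF that(2)]
    by (meson rtrancl_trans symD)
  then show ?thesis by (simp add: connected_in_def)
qed

lemma steiner_superset: "E \<subseteq> steiner S E"
  by (auto simp: steiner_def)

text \<open>The whole tree is a connected superset of \<open>E\<close>, so the intersection runs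
  over a nonempty family. An empty family would yield the universe, whose \<open>card\<close> is 0,
  and no lower bound on the step cost could follow.\<close>

lemma steiner_subset: "E \<subseteq> set_tree S \<Longrightarrow> steiner S E \<subseteq> set_tree S"
  using connected_in_set_tree by (auto simp: steiner_def)

lemma steiner_empty: "steiner S {} = {}"
  by (auto simp: steiner_def connected_in_def)

section \<open>Greedy Future leaves a stable tree unchanged\<close>

lemma set_decomp: "fst ` set (fst (decomp x S d)) = path_keys x S"
  by (induction S arbitrary: d) (auto simp: Let_def split_beta)

lemma decomp_depth: "p \<in> set (fst (decomp x S d)) \<Longrightarrow> d \<le> snd p"
proof (induction S arbitrary: d)
  case (Node l a r)
  from Node.prems Node.IH[of "Suc d"] show ?case
    by (fastforce simp: Let_def split_beta split: if_splits)
qed simp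

lemma length_decomp: "length (snd (decomp x S d)) = Suc (length (fst (decomp x S d)))"
  by (induction S arbitrary: d) (auto simp: Let_def split_beta)

lemma sorted_decomp: "bst S \<Longrightarrow> sorted_wrt (<) (map fst (fst (decomp x S d)))"
proof (induction S arbitrary: d)
  case (Node l a r)
  have "k < a" if "k \<in> fst ` set (fst (decomp x l e))" for k e
    using that path_keys_subset[of x l] Node.prems unfolding set_decomp by auto
  moreover have "a < k" if "k \<in> fst ` set (fst (decomp x r e))" for k e
    using that path_keys_subset[of x r] Node.prems unfolding set_decomp by auto
  ultimately show ?case
    using Node by (auto simp: Let_def split_beta sorted_wrt_append)
qed simp

lemma argmin_idx_eqI:
  assumes "j < length ps"
    and "\<And>i. i < length ps \<Longrightarrow> i \<noteq> j \<Longrightarrow> fst (ps ! j) \<le> fst (ps ! i) \<and> snd (ps ! j) < snd (ps ! i)"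
  shows "argmin_idx ps = j"
  unfolding argmin_idx_def
proof (rule Least_equality)
  show "j < length ps \<and> (\<forall>i<length ps. fst (ps ! j) < fst (ps ! i) \<or>
      fst (ps ! j) = fst (ps ! i) \<and> snd (ps ! j) \<le> snd (ps ! i))"
    using assms by (metis order.order_iff_strict)
next
  fix k
  assume "k < length ps \<and> (\<forall>i<length ps. fst (ps ! k) < fst (ps ! i) \<or>
      fst (ps ! k) = fst (ps ! i) \<and> snd (ps ! k) \<le> snd (ps ! i))"
  then show "j \<le> k" using assms by (metis leD order.refl)
qed

text \<open>Weak monotonicity of the priority down the path is enough: among equal priorities the
  smaller depth wins, and depth grows strictly below the root, so each subpath root is the unique
  minimum. The offset \<open>d\<close> is arbitrary because the recursion enters a child one level
  deeper.\<close>

lemma build_decomp: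
  fixes f :: "nat \<Rightarrow> nat"
  assumes "bst S"
    and "\<And>a b. a \<in> path_keys x S \<Longrightarrow> b \<in> path_keys x S \<Longrightarrow> a \<in> path_keys b S \<Longrightarrow> f a \<le> f b"
  shows "build (map (\<lambda>(k, e). (k, (f k, e))) (fst (decomp x S d))) (snd (decomp x S d)) = S"
  using assms
proof (induction S arbitrary: d)
  case (Node l a r)
  let ?g = "\<lambda>(k, e). (k, (f k, e))"
  have root: "f a \<le> f b" if "b \<in> path_keys x (Node l a r)" for b
    using that by (intro Node.prems(2)) auto
  consider "x < a" | "x = a" | "a < x" by force
  then show ?case
  proof cases
    case 1
    obtain vs rs where d: "decomp x l (Suc d) = (vs, rs)" by force
    have vs: "f a \<le> f k \<and> d < e" if "(k, e) \<in> set vs" for k e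
    proof -
      have "k \<in> path_keys x l"
        using set_decomp[of x l "Suc d"] d that by force
      then show ?thesis
        using root[of k] 1 decomp_depth[of "(k, e)" x l "Suc d"] d that by auto
    qed
    have "f u \<le> f b" if "u \<in> path_keys x l" "b \<in> path_keys x l" "u \<in> path_keys b l" for u b
    proof -
      have "b < a" using that(2) path_keys_subset[of x l] Node.prems(1) by auto
      then show ?thesis using Node.prems(2)[of u b] that 1 by auto
    qed
    then have IH: "build (map ?g vs) rs = l"
      using Node.IH(1)[of "Suc d"] Node.prems(1) d by simp
    have len: "length rs = Suc (length vs)" using length_decomp[of x l "Suc d"] d by simp
    have "argmin_idx (map snd (map ?g (vs @ [(a, d)]))) = length vs"
    proof (rule argmin_idx_eqI)
      fix i assume "i < length (map snd (map ?g (vs @ [(a, d)])))" "i \<noteq> length vs"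
      then have "i < length vs" by simp
      moreover from this have "vs ! i \<in> set vs" by simp
      ultimately show "fst (map snd (map ?g (vs @ [(a, d)])) ! length vs)
          \<le> fst (map snd (map ?g (vs @ [(a, d)])) ! i) \<and>
          snd (map snd (map ?g (vs @ [(a, d)])) ! length vs)
          < snd (map snd (map ?g (vs @ [(a, d)])) ! i)"
        using vs[of "fst (vs ! i)" "snd (vs ! i)"] by (simp add: nth_append split_beta)
    qed simp
    then have "build (map ?g (vs @ [(a, d)])) (rs @ [r]) = Node (build (map ?g vs) rs) a (build [] [r])"
      using len by (subst build.simps) (simp add: Let_def nth_append)
    then show ?thesis using 1 d IH by simp
  next
    case 2
    have "argmin_idx [(f a, d)] = 0" by (rule argmin_idx_eqI) auto
    then show ?thesis using 2 by simp
  next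
    case 3
    obtain vs rs where d: "decomp x r (Suc d) = (vs, rs)" by force
    have vs: "f a \<le> f k \<and> d < e" if "(k, e) \<in> set vs" for k e
    proof -
      have "k \<in> path_keys x r"
        using set_decomp[of x r "Suc d"] d that by force
      then show ?thesis
        using root[of k] 3 decomp_depth[of "(k, e)" x r "Suc d"] d that by auto
    qed
    have "f u \<le> f b" if "u \<in> path_keys x r" "b \<in> path_keys x r" "u \<in> path_keys b r" for u b
    proof -
      have "a < b" using that(2) path_keys_subset[of x r] Node.prems(1) by auto
      then show ?thesis using Node.prems(2)[of u b] that 3 by auto
    qed
    then have IH: "build (map ?g vs) rs = r"
      using Node.IH(2)[of "Suc d"] Node.prems(1) d by simp
    have "argmin_idx (map snd (map ?g ((a, d) # vs))) = 0"
    proof (rule argmin_idx_eqI)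
      fix i assume "i < length (map snd (map ?g ((a, d) # vs)))" "i \<noteq> 0"
      then obtain k where "i = Suc k" "k < length vs" by (cases i) auto
      moreover from this have "vs ! k \<in> set vs" by simp
      ultimately show "fst (map snd (map ?g ((a, d) # vs)) ! 0)
          \<le> fst (map snd (map ?g ((a, d) # vs)) ! i) \<and>
          snd (map snd (map ?g ((a, d) # vs)) ! 0) < snd (map snd (map ?g ((a, d) # vs)) ! i)"
        using vs[of "fst (vs ! k)" "snd (vs ! k)"] by (simp add: split_beta)
    qed simp
    then have "build (map ?g ((a, d) # vs)) (l # rs) = Node (build [] [l]) a (build (map ?g vs) rs)"
      by (subst build.simps) (simp add: Let_def)
    then show ?thesis using 3 d IH by simp
  qed
qed simp

definition visible :: "nat set \<Rightarrow> nat \<Rightarrow> nat \<Rightarrow> bool" where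
  "visible P a y \<longleftrightarrow> (\<forall>w\<in>P. (w < a \<longrightarrow> w < y) \<and> (a < w \<longrightarrow> y < w))"

text \<open>\<open>visible\<close> is the interval between the neighbours of a path key, freed of
  indices: \<open>y\<close> lies on the same side as \<open>a\<close> of every other path key. In a
  sorted list the nearest keys imply the conditions for all others.\<close>

lemma in_interval_iff_visible:
  assumes "sorted_wrt (<) ks" "i < length ks"
  shows "in_interval (if i = 0 then None else Some (ks ! (i - 1)))
      (if Suc i = length ks then None else Some (ks ! Suc i)) y \<longleftrightarrow> visible (set ks) (ks ! i) y"
    (is "?I \<longleftrightarrow> ?V")
proof
  note lt = sorted_wrt_nth_less[OF assms(1)]
  have le: "ks ! j \<le> ks ! k" if "j \<le> k" "k < length ks" for j k
    using lt[of j k] that by (cases "j = k") auto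
  assume I: ?I
  show ?V
    unfolding visible_def
  proof
    fix w assume "w \<in> set ks"
    then obtain j where j: "j < length ks" "w = ks ! j" by (auto simp: in_set_conv_nth)
    consider "j < i" | "j = i" | "i < j" by force
    then show "(w < ks ! i \<longrightarrow> w < y) \<and> (ks ! i < w \<longrightarrow> y < w)"
    proof cases
      case 1
      then have "ks ! (i - 1) < y" using I by (auto simp: in_interval_def)
      moreover have "ks ! j \<le> ks ! (i - 1)" using le 1 assms(2) by simp
      ultimately show ?thesis using lt[of j i] 1 j assms(2) by simp
    next
      case 3
      then have "y < ks ! Suc i" using I j by (auto simp: in_interval_def)
      then show ?thesis using le[of "Suc i" j] lt[of i j] 3 j by simp
    qed (use j in simp)
  qed
next
  assume V: ?V
  note lt = sorted_wrt_nth_less[OF assms(1)]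
  have "ks ! (i - 1) < y" if "i \<noteq> 0"
  proof -
    have "ks ! (i - 1) < ks ! i" "ks ! (i - 1) \<in> set ks" using lt[of "i - 1" i] that assms(2) by auto
    then show ?thesis using V by (auto simp: visible_def)
  qed
  moreover have "y < ks ! Suc i" if "Suc i \<noteq> length ks"
  proof -
    have "Suc i < length ks" using that assms(2) by simp
    then have "ks ! i < ks ! Suc i" "ks ! Suc i \<in> set ks" using lt[of i "Suc i"] by auto
    then show ?thesis using V by (auto simp: visible_def)
  qed
  ultimately show ?I by (auto simp: in_interval_def)
qed

definition next_in :: "nat list \<Rightarrow> nat \<Rightarrow> nat set \<Rightarrow> nat" where
  "next_in X t D =
     (if \<exists>s. t < s \<and> s < length X \<and> X ! s \<in> D
      then (LEAST s. t < s \<and> s < length X \<and> X ! s \<in> D) else length X)"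

lemma next_in_antimono:
  assumes "D \<subseteq> D'"
  shows "next_in X t D' \<le> next_in X t D"
proof (cases "\<exists>s. t < s \<and> s < length X \<and> X ! s \<in> D")
  case True
  let ?s = "LEAST s. t < s \<and> s < length X \<and> X ! s \<in> D"
  have "t < ?s \<and> ?s < length X \<and> X ! ?s \<in> D" using LeastI_ex[OF True] .
  then have *: "t < ?s \<and> ?s < length X \<and> X ! ?s \<in> D'" using assms by auto
  then have "next_in X t D' = (LEAST s. t < s \<and> s < length X \<and> X ! s \<in> D')"
    unfolding next_in_def by meson
  also have "\<dots> \<le> ?s" using * by (rule Least_le)
  finally show ?thesis using True by (simp add: next_in_def)
next
  case False
  have "next_in X t D' \<le> length X"
  proof (cases "\<exists>s. t < s \<and> s < length X \<and> X ! s \<in> D'")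
    case True
    then have "next_in X t D' < length X"
      using LeastI_ex[OF True] by (simp add: next_in_def)
    then show ?thesis by simp
  next
    case False
    then show ?thesis unfolding next_in_def by (subst if_not_P) auto
  qed
  moreover have "next_in X t D = length X"
    unfolding next_in_def using False by (rule if_not_P)
  ultimately show ?thesis by simp
qed

text \<open>The interval may be a proper part of \<open>D\<close>. Both have the same next hitting
  time as soon as the earliest later query to \<open>D\<close> falls into the interval, so
  \<open>first\<close> demands membership only for that query.\<close>

lemma next_time_eq_next_in:
  assumes sub: "\<And>s. t < s \<Longrightarrow> s < length X \<Longrightarrow> in_interval lo hi (X ! s) \<Longrightarrow> X ! s \<in> D"
    and first: "\<And>s. t < s \<Longrightarrow> s < length X \<Longrightarrow> X ! s \<in> D \<Longrightarrow> (\<And>r. t < r \<Longrightarrow> r < s \<Longrightarrow> X ! r \<notin> D)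
      \<Longrightarrow> in_interval lo hi (X ! s)"
  shows "next_time X t lo hi = next_in X t D"
proof (cases "\<exists>s. t < s \<and> s < length X \<and> X ! s \<in> D")
  case True
  let ?s = "LEAST s. t < s \<and> s < length X \<and> X ! s \<in> D"
  have s: "t < ?s" "?s < length X" "X ! ?s \<in> D" using LeastI_ex[OF True] by auto
  have "X ! r \<notin> D" if "t < r" "r < ?s" for r
    using not_less_Least[OF that(2)] that s(2) by auto
  then have I: "t < ?s \<and> ?s < length X \<and> in_interval lo hi (X ! ?s)"
    using first s by blast
  then have "next_time X t lo hi = (LEAST s. t < s \<and> s < length X \<and> in_interval lo hi (X ! s))"
    unfolding next_time_def by meson
  also have "\<dots> = ?s"
  proof (rule Least_equality, rule I)
    fix r assume "t < r \<and> r < length X \<and> in_interval lo hi (X ! r)"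
    then have "t < r \<and> r < length X \<and> X ! r \<in> D" using sub by blast
    then show "?s \<le> r" by (rule Least_le)
  qed
  finally show ?thesis using True by (simp add: next_in_def)
next
  case False
  then have no: "\<not> (\<exists>s. t < s \<and> s < length X \<and> in_interval lo hi (X ! s))" using sub by blast
  show ?thesis unfolding next_in_def next_time_def if_not_P[OF False] if_not_P[OF no] ..
qed

lemma gf_step_fixed:
  assumes "bst T" "set X \<subseteq> set_tree T"
    and below: "\<And>a y. a \<in> path_keys (X ! t) T \<Longrightarrow> y \<in> set_tree T \<Longrightarrow>
      visible (path_keys (X ! t) T) a y \<Longrightarrow> y \<in> keys_below T a"
    and first: "\<And>a s. a \<in> path_keys (X ! t) T \<Longrightarrow> t < s \<Longrightarrow> s < length X \<Longrightarrow>
      X ! s \<in> keys_below T a \<Longrightarrow> (\<And>r. t < r \<Longrightarrow> r < s \<Longrightarrow> X ! r \<notin> keys_below T a) \<Longrightarrow>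
      visible (path_keys (X ! t) T) a (X ! s)"
  shows "gf_step X t T = T"
proof -
  let ?x = "X ! t"
  obtain vd rs where d: "decomp ?x T 0 = (vd, rs)" by force
  define ks where "ks = map fst vd"
  define f where "f a = next_in X t (keys_below T a)" for a
  have ks: "sorted_wrt (<) ks" "set ks = path_keys ?x T" "length ks = length vd"
    using sorted_decomp[OF assms(1), of ?x 0] set_decomp[of ?x T 0] d by (auto simp: ks_def)
  have nt: "next_time X t (if i = 0 then None else Some (ks ! (i - 1)))
      (if Suc i = length ks then None else Some (ks ! Suc i)) = f (ks ! i)"
    if i: "i < length ks" for i
    unfolding f_def
  proof (rule next_time_eq_next_in)
    have a: "ks ! i \<in> path_keys ?x T" using ks(2) i nth_mem by blast
    note iv = in_interval_iff_visible[OF ks(1) i, unfolded ks(2)]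
    show "X ! s \<in> keys_below T (ks ! i)"
      if "t < s" "s < length X" "in_interval (if i = 0 then None else Some (ks ! (i - 1)))
        (if Suc i = length ks then None else Some (ks ! Suc i)) (X ! s)" for s
      using below[OF a] that(3) assms(2) that(2) nth_mem unfolding iv by blast
    show "in_interval (if i = 0 then None else Some (ks ! (i - 1)))
        (if Suc i = length ks then None else Some (ks ! Suc i)) (X ! s)"
      if "t < s" "s < length X" "X ! s \<in> keys_below T (ks ! i)"
        "\<And>r. t < r \<Longrightarrow> r < s \<Longrightarrow> X ! r \<notin> keys_below T (ks ! i)" for s
      unfolding iv by (rule first[OF a that])
  qed
  have "map (\<lambda>i. (fst (vd ! i),
        (next_time X t (if i = 0 then None else Some (fst (vd ! (i - 1))))
          (if Suc i = length vd then None else Some (fst (vd ! Suc i))), snd (vd ! i))))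
      [0..<length vd] = map (\<lambda>(k, e). (k, (f k, e))) vd" (is "map ?h _ = _")
  proof (rule nth_equalityI)
    fix i assume "i < length (map ?h [0..<length vd])"
    then have i: "i < length vd" by simp
    have lo: "(if i = 0 then None else Some (fst (vd ! (i - 1)))) =
        (if i = 0 then None else Some (ks ! (i - 1)))"
      using i by (simp add: ks_def)
    have hi: "(if Suc i = length vd then None else Some (fst (vd ! Suc i))) =
        (if Suc i = length ks then None else Some (ks ! Suc i))"
      using i by (simp add: ks_def)
    have key: "fst (vd ! i) = ks ! i" using i by (simp add: ks_def)
    have "next_time X t (if i = 0 then None else Some (fst (vd ! (i - 1))))
        (if Suc i = length vd then None else Some (fst (vd ! Suc i))) = f (fst (vd ! i))"
      unfolding lo hi key by (rule nt) (simp add: i ks(3))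
    then have "?h i = (fst (vd ! i), f (fst (vd ! i)), snd (vd ! i))" by blast
    then show "map ?h [0..<length vd] ! i = map (\<lambda>(k, e). (k, (f k, e))) vd ! i"
      using i by (simp only: nth_map nth_upt length_upt split_beta diff_zero add_0)
  qed simp
  then have "gf_step X t T = build (map (\<lambda>(k, e). (k, (f k, e))) vd) rs"
    unfolding gf_step_def d by (simp add: Let_def)
  also have "\<dots> = T"
  proof -
    \<comment> \<open>Descendant sets shrink down the tree, so the waiting times for their next
      query can only grow.\<close>
    have "f a \<le> f b" if "a \<in> path_keys b T" for a b
      unfolding f_def using path_keys_trans[OF assms(1) that]
      by (intro next_in_antimono) (auto simp: keys_below_def)
    then show ?thesis using build_decomp[OF assms(1), of ?x f 0] d by simp
  qed
  finally show ?thesis .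
qed

text \<open>Each path key above \<open>a\<close> has \<open>y\<close> on the same side as
  \<open>a\<close>, so the search for \<open>y\<close> follows the path at least down to
  \<open>a\<close>.\<close>

lemma visible_imp_below:
  assumes "bst T" "a \<in> path_keys x T" "visible (path_keys x T) a y" "y \<in> set_tree T"
  shows "y \<in> keys_below T a"
  using assms
proof (induction T)
  case (Node l b r)
  show ?case
  proof (cases "a = b")
    case True
    then show ?thesis using Node.prems by (simp add: keys_below_def)
  next
    case False
    consider "x < b" | "b < x" using False Node.prems(2) by force
    then show ?thesis
    proof cases
      case 1
      then have a: "a \<in> path_keys x l" using False Node.prems(2) by simp
      then have "a < b" using path_keys_subset[of x l] Node.prems(1) by auto
      then have "y < b" using Node.prems(3) by (simp add: visible_def)
      moreover from this have "y \<in> set_tree l" using Node.prems(1,4) by auto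
      moreover have "visible (path_keys x l) a y"
        using Node.prems(3) 1 by (simp add: visible_def)
      ultimately show ?thesis
        using Node.IH(1) Node.prems(1) a by (simp add: keys_below_def)
    next
      case 2
      then have a: "a \<in> path_keys x r" using False Node.prems(2) by simp
      then have "b < a" using path_keys_subset[of x r] Node.prems(1) by auto
      then have "b < y" using Node.prems(3) 2 by (simp add: visible_def)
      moreover from this have "y \<in> set_tree r" using Node.prems(1,4) by auto
      moreover have "visible (path_keys x r) a y"
        using Node.prems(3) 2 by (simp add: visible_def)
      ultimately show ?thesis
        using Node.IH(2) Node.prems(1) a by (auto simp: keys_below_def)
    qed
  qed
qed simp

text \<open>Path keys outside \<open>v\<close> lie beyond all keys of \<open>v\<close>, hence cannot
  separate \<open>y\<close> from the root of \<open>v\<close>. Visibility is thus a matter of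
  \<open>v\<close> alone.\<close>

lemma visible_subtree:
  assumes "bst T" "v \<in> subtrees T" "v \<noteq> Leaf" "x \<in> set_tree v" "y \<in> set_tree v"
    and "visible (path_keys x v) (value v) y"
  shows "visible (path_keys x T) (value v) y"
  unfolding visible_def
proof
  fix w assume "w \<in> path_keys x T"
  with path_keys_subtree[OF assms(1,2,4)]
  consider "w \<in> path_keys x v" | "\<forall>y\<in>set_tree v. w < y" | "\<forall>y\<in>set_tree v. y < w" by blast
  moreover have "value v \<in> set_tree v" using assms(3) by (cases v) auto
  ultimately show "(w < value v \<longrightarrow> w < y) \<and> (value v < w \<longrightarrow> y < w)"
    using assms(5,6) by cases (auto simp: visible_def dest: order.strict_trans)
qed

text \<open>Below its root, the path to \<open>x\<close> inside \<open>v\<close> stays on the side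
  of \<open>x\<close>, so no path key of \<open>v\<close> bounds the interval on the opposite
  side.\<close>

lemma visible_opposite:
  assumes "bst v" "v \<noteq> Leaf"
    and "x \<in> set_tree (left v) \<and> y \<in> set_tree (right v) \<or> x \<in> set_tree (right v) \<and> y \<in> set_tree (left v)"
  shows "visible (path_keys x v) (value v) y"
proof -
  obtain l a r where v: "v = Node l a r" using assms(2) by (cases v) auto
  then have b: "\<forall>k\<in>set_tree l. k < a" "\<forall>k\<in>set_tree r. a < k" using assms(1) by auto
  from assms(3) show ?thesis
  proof
    assume xy: "x \<in> set_tree (left v) \<and> y \<in> set_tree (right v)"
    then have "x < a" "a < y" using v b by auto
    moreover have "\<forall>w\<in>path_keys x l. w < a" using path_keys_subset[of x l] b by auto
    ultimately show ?thesis unfolding v visible_def by auto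
  next
    assume xy: "x \<in> set_tree (right v) \<and> y \<in> set_tree (left v)"
    then have "a < x" "y < a" using v b by auto
    moreover have "\<forall>w\<in>path_keys x r. a < w" using path_keys_subset[of x r] b by auto
    ultimately show ?thesis unfolding v visible_def by auto
  qed
qed

text \<open>The only case of two successive queries on the same side of the node. The path to
  \<open>x\<close> turns left at \<open>b\<close>, so \<open>b\<close> is the left neighbour of
  \<open>a\<close> on it, and \<open>B\<close> is exactly what lies between them. With
  \<open>A\<close> and \<open>B\<close> exchanged the claim fails, since \<open>b\<close> would then
  separate \<open>y\<close> from \<open>a\<close>.\<close>

lemma visible_weak_left:
  assumes "bst (Node (Node A b B) a C)" "x \<in> set_tree A" "y \<in> set_tree B"
  shows "visible (path_keys x (Node (Node A b B) a C)) a y"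
proof -
  have o: "x < b" "b < a" "b < y" "y < a" using assms by auto
  moreover have "\<forall>w\<in>path_keys x A. w < b" using path_keys_subset[of x A] assms(1) by auto
  ultimately show ?thesis unfolding visible_def by auto
qed

lemma visible_weak_right:
  assumes "bst (Node C a (Node B b A))" "x \<in> set_tree A" "y \<in> set_tree B"
  shows "visible (path_keys x (Node C a (Node B b A))) a y"
proof -
  have o: "b < x" "a < b" "y < b" "a < y" using assms by auto
  moreover have "\<forall>w\<in>path_keys x A. b < w" using path_keys_subset[of x A] assms(1) by auto
  ultimately show ?thesis unfolding visible_def by auto
qed

text \<open>Translates between the two clocks: Greedy Future looks at times in \<open>X\<close>,
  stability at positions in the subsequence of a node.\<close>

lemma filter_consecutive:
  assumes "t < s" "s < length X" "P (X ! t)" "P (X ! s)" "\<And>r. t < r \<Longrightarrow> r < s \<Longrightarrow> \<not> P (X ! r)"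
  shows "\<exists>i. Suc i < length (filter P X) \<and> filter P X ! i = X ! t \<and> filter P X ! Suc i = X ! s"
proof -
  define M where "M = take (s - Suc t) (drop (Suc t) X)"
  have "drop (Suc t) X = M @ drop s X"
    using assms(1) unfolding M_def
    by (metis Suc_leI append_take_drop_id drop_drop le_add_diff_inverse2)
  then have X: "X = take t X @ X ! t # M @ X ! s # drop (Suc s) X"
    using assms(1,2) by (metis Cons_nth_drop_Suc id_take_nth_drop order.strict_trans)
  have "filter P M = []"
    using assms(1,2,5) by (auto simp: M_def filter_empty_conv in_set_conv_nth)
  then have "filter P X = filter P (take t X) @ X ! t # X ! s # filter P (drop (Suc s) X)"
    by (subst X) (simp add: assms(3,4))
  then show ?thesis
    by (intro exI[of _ "length (filter P (take t X))"]) (simp add: nth_append)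
qed

text \<open>A key determines its set of descendants. If \<open>x\<close> were the key of
  \<open>v\<close>, then \<open>v\<close> would hold as many keys as the leaf \<open>x\<close>,
  namely one, although its left child is nonempty.\<close>

lemma leaf_key_in_inner:
  assumes "bst T" "v \<in> inner_nodes T" "leaf_key T x" "x \<in> set_tree v"
  shows "x \<in> set_tree (left v) \<or> x \<in> set_tree (right v)"
proof (rule ccontr)
  assume no: "\<not> ?thesis"
  have v: "v \<in> subtrees T" "v \<noteq> Leaf" "left v \<noteq> Leaf" using assms(2) by (auto simp: inner_nodes_def)
  then have x: "x = value v" using no assms(4) by (cases v) auto
  have "set_tree v = {x}"
    using keys_below_value[OF assms(1) v(1,2)] keys_below_value[OF assms(1), of "Node Leaf x Leaf"]
      assms(3) x by (simp add: leaf_key_def)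
  moreover have "bst v" using v assms(1) bst_subtrees by blast
  ultimately show False using v(2,3) x by (cases v; cases "left v") auto
qed

lemma leaf_key_in_tree: "leaf_key T x \<Longrightarrow> x \<in> set_tree T"
  unfolding leaf_key_def using set_tree_subtrees by fastforce

lemma weakly_stable_leftE:
  assumes "weakly_stable_left v X" "v \<noteq> Leaf"
  obtains A b B a C where "v = Node (Node A b B) a C" "A \<noteq> Leaf" "cyclic3 A B C (subseq_in v X)"
  using assms by (cases v; cases "left v") (auto simp: weakly_stable_left_def Let_def)

lemma weakly_stable_rightE:
  assumes "weakly_stable_right v X" "v \<noteq> Leaf"
  obtains A b B a C where "v = Node C a (Node B b A)" "B \<noteq> Leaf" "cyclic3 A B C (subseq_in v X)"
  using assms by (cases v; cases "right v") (auto simp: weakly_stable_right_def Let_def)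

lemma next_query_visible:
  assumes "bst T" "mixed_stable T X" "v \<in> subtrees T" "v \<noteq> Leaf" "t < s" "s < length X"
    and "X ! t \<in> set_tree v" "X ! s \<in> set_tree v" "\<And>r. t < r \<Longrightarrow> r < s \<Longrightarrow> X ! r \<notin> set_tree v"
  shows "visible (path_keys (X ! t) T) (value v) (X ! s)"
proof (rule visible_subtree[OF assms(1,3,4,7,8)])
  have v: "bst v" "full v" using assms bst_subtrees full_subtrees by (auto simp: mixed_stable_def)
  show "visible (path_keys (X ! t) v) (value v) (X ! s)"
  proof (cases "left v = Leaf")
    \<comment> \<open>A node without children holds a single key, so both queries equal it.\<close>
    case True
    then have "right v = Leaf" using v(2) assms(4) by (cases v) auto
    then show ?thesis using True assms(4,7,8) by (cases v) (auto simp: visible_def)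
  next
    case False
    then have inner: "v \<in> inner_nodes T" using assms(3,4) by (simp add: inner_nodes_def)
    have disj: "set_tree (left v) \<inter> set_tree (right v) = {}"
      using v(1) by (cases v) (auto dest: order.strict_trans)
    have "\<exists>i. Suc i < length (subseq_in v X) \<and> subseq_in v X ! i = X ! t
        \<and> subseq_in v X ! Suc i = X ! s"
      unfolding subseq_in_def using filter_consecutive[OF assms(5,6), of "\<lambda>x. x \<in> set_tree v"] assms(7-9)
      by blast
    then obtain i where i: "Suc i < length (subseq_in v X)" "subseq_in v X ! i = X ! t"
      "subseq_in v X ! Suc i = X ! s" by blast
    have leaf: "leaf_key T (X ! t)" "leaf_key T (X ! s)"
      using assms(2,5,6) by (auto simp: mixed_stable_def leaf_queries_def)
    note sides = leaf_key_in_inner[OF assms(1) inner leaf(1) assms(7)]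
      leaf_key_in_inner[OF assms(1) inner leaf(2) assms(8)]
    have cyc: "X ! t \<in> set_tree A \<and> X ! s \<in> set_tree B \<or> X ! t \<in> set_tree B \<and> X ! s \<in> set_tree C \<or>
        X ! t \<in> set_tree C \<and> X ! s \<in> set_tree A" if "cyclic3 A B C (subseq_in v X)" for A B C
    proof -
      from that obtain p where p: "X ! t \<in> set_tree ([A, B, C] ! ((i + p) mod 3))"
        "X ! s \<in> set_tree ([A, B, C] ! (Suc (i + p) mod 3))"
        unfolding cyclic3_def using i by (metis Suc_lessD add_Suc)
      consider "(i + p) mod 3 = 0" "Suc (i + p) mod 3 = 1" | "(i + p) mod 3 = 1" "Suc (i + p) mod 3 = 2"
        | "(i + p) mod 3 = 2" "Suc (i + p) mod 3 = 0" by (metis mod_Suc numeral_3_eq_3 One_nat_def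
          Suc_1 mod_less_divisor less_Suc_eq not_less0 zero_less_Suc)
      then show ?thesis using p by cases auto
    qed
    have "strongly_stable_node v X \<or> weakly_stable_left v X \<or> weakly_stable_right v X"
      using assms(2) inner by (simp add: mixed_stable_def)
    then show ?thesis
    proof (elim disjE)
      assume "strongly_stable_node v X"
      then have "X ! t \<in> set_tree (left v) \<longleftrightarrow> X ! s \<in> set_tree (right v)"
        using i by (auto simp: strongly_stable_node_def Let_def)
      then show ?thesis using sides disj visible_opposite[OF v(1) assms(4)] by blast
    next
      assume "weakly_stable_left v X"
      then obtain A b B a C where vv: "v = Node (Node A b B) a C" "cyclic3 A B C (subseq_in v X)"
        using assms(4) by (rule weakly_stable_leftE)
      from cyc[OF vv(2)] show ?thesis
        using visible_weak_left[of A b B a C] visible_opposite[OF v(1) assms(4), of "X ! t" "X ! s"]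
          v(1) vv(1) by (auto simp del: path_keys.simps)
    next
      assume "weakly_stable_right v X"
      then obtain A b B a C where vv: "v = Node C a (Node B b A)" "cyclic3 A B C (subseq_in v X)"
        using assms(4) by (rule weakly_stable_rightE)
      from cyc[OF vv(2)] show ?thesis
        using visible_weak_right[of C a B b A] visible_opposite[OF v(1) assms(4), of "X ! t" "X ! s"]
          v(1) vv(1) by (auto simp del: path_keys.simps)
    qed
  qed
qed

lemma gf_step_stable:
  assumes "bst T" "mixed_stable T X" "t < length X"
  shows "gf_step X t T = T"
proof (rule gf_step_fixed[OF assms(1)])
  show X: "set X \<subseteq> set_tree T"
    using assms(2) leaf_key_in_tree by (auto simp: mixed_stable_def leaf_queries_def)
  show "y \<in> keys_below T a" if "a \<in> path_keys (X ! t) T" "y \<in> set_tree T"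
    "visible (path_keys (X ! t) T) a y" for a y
    using visible_imp_below[OF assms(1)] that by blast
  fix a s assume a: "a \<in> path_keys (X ! t) T" and s: "t < s" "s < length X"
    "X ! s \<in> keys_below T a" "\<And>r. t < r \<Longrightarrow> r < s \<Longrightarrow> X ! r \<notin> keys_below T a"
  from a obtain v where v: "v \<in> subtrees T" "v \<noteq> Leaf" "value v = a"
    using path_key_is_value by blast
  have eq: "keys_below T a = set_tree v" using keys_below_value[OF assms(1) v(1,2)] v(3) by simp
  have "X ! t \<in> keys_below T a" using a X assms(3) by (auto simp: keys_below_def)
  then show "visible (path_keys (X ! t) T) a (X ! s)"
    using next_query_visible[OF assms(1,2) v(1,2) s(1,2)] s eq v(3) by simp
qed

lemma gf_cost_le:
  assumes "bst T" "mixed_stable T X"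
  shows "gf_cost X T \<le> (\<Sum>t<length X. card (path_keys (X ! t) T))"
proof -
  have gf: "t \<le> length X \<Longrightarrow> gf_tree X T t = T" for t
    by (induction t) (simp_all add: gf_step_stable[OF assms])
  \<comment> \<open>Since the tree never changes, empty rotation lists realise every transition and
    compete in the minimum that defines \<open>gf_cost\<close>.\<close>
  have "valid_run X T (gf_tree X T) (\<lambda>_. [])"
    unfolding valid_run_def using gf by (auto simp: gf_step_stable[OF assms] intro: rots_nil)
  then have "gf_cost X T \<le> run_cost X (gf_tree X T) (\<lambda>_. [])"
    unfolding gf_cost_def by (intro Least_le) blast
  also have "\<dots> = (\<Sum>t<length X. card (path_keys (X ! t) T))"
    unfolding run_cost_def step_cost_def
    by (intro sum.cong) (simp_all add: gf endpoints_def steiner_empty)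
  finally show ?thesis .
qed

section \<open>A lower bound for every run\<close>

text \<open>The key of \<open>v\<close> has to join one side so that two adjacent intervals exhaust
  the subtree. Which side is immaterial for leaf queries, as none of them hits that key.\<close>

definition left_region :: "nat tree \<Rightarrow> nat set" where
  "left_region v = insert (value v) (set_tree (left v))"

definition right_region :: "nat tree \<Rightarrow> nat set" where
  "right_region v = set_tree (right v)"

lemma regions_union: "v \<noteq> Leaf \<Longrightarrow> left_region v \<union> right_region v = set_tree v"
  by (cases v) (auto simp: left_region_def right_region_def)

lemma regions_disjoint: "bst v \<Longrightarrow> v \<noteq> Leaf \<Longrightarrow> left_region v \<inter> right_region v = {}"
  by (cases v) (auto simp: left_region_def right_region_def dest: order.strict_trans)

lemma convex_in_subtree:
  "bst T \<Longrightarrow> v \<in> subtrees T \<Longrightarrow> convex_in (set_tree T) (set_tree v)"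
proof (induction T)
  case (Node l a r)
  consider "v = Node l a r" | "v \<in> subtrees l" | "v \<in> subtrees r" using Node.prems by auto
  then show ?case
  proof cases
    case 1
    then show ?thesis by (simp add: convex_in_def)
  next
    case 2
    then have c: "convex_in (set_tree l) (set_tree v)" using Node by simp
    then have sub: "set_tree v \<subseteq> set_tree l" by (simp add: convex_in_def)
    show ?thesis
      unfolding convex_in_def
    proof (intro conjI ballI impI)
      fix x y k assume xy: "x \<in> set_tree v" "y \<in> set_tree v" "k \<in> set_tree (Node l a r)" "x \<le> k" "k \<le> y"
      have "y < a" using sub xy(2) Node.prems(1) by auto
      with xy(5) have "k < a" by simp
      then have "k \<in> set_tree l" using xy(3) Node.prems(1) by auto
      then show "k \<in> set_tree v" using c xy unfolding convex_in_def by blast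
    qed (use sub in auto)
  next
    case 3
    then have c: "convex_in (set_tree r) (set_tree v)" using Node by simp
    then have sub: "set_tree v \<subseteq> set_tree r" by (simp add: convex_in_def)
    show ?thesis
      unfolding convex_in_def
    proof (intro conjI ballI impI)
      fix x y k assume xy: "x \<in> set_tree v" "y \<in> set_tree v" "k \<in> set_tree (Node l a r)" "x \<le> k" "k \<le> y"
      have "a < x" using sub xy(1) Node.prems(1) by auto
      with xy(4) have "a < k" by simp
      then have "k \<in> set_tree r" using xy(3) Node.prems(1) by auto
      then show "k \<in> set_tree v" using c xy unfolding convex_in_def by blast
    qed (use sub in auto)
  qed
qed (simp add: convex_in_def)

lemma convex_in_left_region:
  assumes "bst T" "v \<in> subtrees T" "v \<noteq> Leaf"
  shows "convex_in (set_tree T) (left_region v)"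
proof -
  have c: "convex_in (set_tree T) (set_tree v)" using convex_in_subtree assms by blast
  have b: "bst v" using bst_subtrees assms by blast
  have L: "left_region v = {k \<in> set_tree v. k \<le> value v}"
    using b assms(3) by (cases v) (auto simp: left_region_def intro: less_imp_le)
  show ?thesis using c unfolding L convex_in_def by (blast intro: order.trans)
qed

lemma subtrees_comparable:
  assumes "bst T" "u \<in> subtrees T" "v \<in> subtrees T"
  shows "set_tree u \<inter> set_tree v = {} \<or> u \<in> subtrees v \<or> v \<in> subtrees u"
  using assms
proof (induction T)
  case (Node l a r)
  have "set_tree l \<inter> set_tree r = {}" using Node.prems(1) by (rule bst_disjoint)
  then have "set_tree u \<inter> set_tree v = {}"
    if "u \<in> subtrees l \<and> v \<in> subtrees r \<or> u \<in> subtrees r \<and> v \<in> subtrees l"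
    using that set_tree_subtrees by blast
  moreover have "u = Node l a r \<or> v = Node l a r \<or>
      u \<in> subtrees l \<and> v \<in> subtrees l \<or> u \<in> subtrees r \<and> v \<in> subtrees r \<or>
      u \<in> subtrees l \<and> v \<in> subtrees r \<or> u \<in> subtrees r \<and> v \<in> subtrees l"
    using Node.prems(2,3) by auto
  moreover have "bst l" "bst r" using Node.prems(1) by auto
  ultimately show ?case using Node.IH Node.prems(2,3) by blast
qed simp

text \<open>This separates the transition points of a node and a proper descendant. A point of the
  outer node has its whole side below it, including everything in the inner subtree; a point of the
  inner node never has that subtree entirely below it.\<close>

lemma transition_nested:
  assumes "transition S L R z" "transition S L' R' z" "L' \<union> R' \<subseteq> L \<or> L' \<union> R' \<subseteq> R" "L \<inter> R = {}"
  shows False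
proof -
  have z: "z \<in> L' \<union> R'" "\<not> L' \<union> R' \<subseteq> keys_below S z"
    using assms(2) by (auto simp: transition_def)
  then have "z \<in> L \<and> L' \<union> R' \<subseteq> L \<or> z \<in> R \<and> L' \<union> R' \<subseteq> R" using assms(3) by blast
  then show False using assms(1,4) z(2) unfolding transition_def by blast
qed

lemma inner_node_child_region:
  assumes "u \<in> subtrees v" "u \<noteq> v" "u \<noteq> Leaf"
  shows "set_tree u \<subseteq> left_region v \<or> set_tree u \<subseteq> right_region v"
  using assms set_tree_subtrees[of u "left v"] set_tree_subtrees[of u "right v"]
  by (cases v) (auto simp: left_region_def right_region_def)

lemma finite_inner_nodes: "finite (inner_nodes T)"
proof -
  have "finite (subtrees T)" by (induction T) auto
  then show ?thesis by (simp add: inner_nodes_def)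
qed

lemma sum_card_swap:
  assumes "finite A" "finite B"
  shows "(\<Sum>a\<in>A. card {b \<in> B. P a b}) = (\<Sum>b\<in>B. card {a \<in> A. P a b})"
proof -
  have "(\<Sum>a\<in>A. card {b \<in> B. P a b}) = (\<Sum>a\<in>A. \<Sum>b\<in>B. if P a b then 1 else 0)"
    using assms by (simp add: sum.If_cases Int_def)
  also have "\<dots> = (\<Sum>b\<in>B. \<Sum>a\<in>A. if P a b then 1 else 0)" by (rule sum.swap)
  also have "\<dots> = (\<Sum>b\<in>B. card {a \<in> A. P a b})"
    using assms by (simp add: sum.If_cases Int_def)
  finally show ?thesis .
qed

definition transition_point :: "nat tree \<Rightarrow> nat tree \<Rightarrow> nat" where
  "transition_point S v = (THE z. transition S (left_region v) (right_region v) z)"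

definition touched :: "nat tree \<Rightarrow> nat \<Rightarrow> (nat \<times> nat) list \<Rightarrow> nat set" where
  "touched S x es = path_keys x S \<union> steiner S (endpoints es)"

lemma full_inner_node:
  assumes "full T" "v \<in> inner_nodes T"
  shows "right v \<noteq> Leaf"
  using assms full_subtrees[of v T] by (cases v) (auto simp: inner_nodes_def)

section \<open>Transition points along an arbitrary run\<close>

locale bst_run =
  fixes T :: "nat tree" and X :: "nat list" and Tr :: "nat \<Rightarrow> nat tree"
    and es :: "nat \<Rightarrow> (nat \<times> nat) list"
  assumes bst: "bst T" and full: "full T" and run: "valid_run X T Tr es"
begin

lemma tree_invariant: "t \<le> length X \<Longrightarrow> bst (Tr t) \<and> set_tree (Tr t) = set_tree T"
proof (induction t)
  case 0
  then show ?case using run bst by (simp add: valid_run_def)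
next
  case (Suc t)
  then have "rots (Tr t) (es t) (Tr (Suc t))" using run by (simp add: valid_run_def)
  with Suc show ?case using rots_invariants by (metis Suc_leD)
qed

lemma transition_iff:
  assumes "t \<le> length X" "v \<in> inner_nodes T"
  shows "transition (Tr t) (left_region v) (right_region v) z \<longleftrightarrow> z = transition_point (Tr t) v"
proof -
  have v: "v \<in> subtrees T" "v \<noteq> Leaf" using assms(2) by (auto simp: inner_nodes_def)
  then have "right v \<in> subtrees T" using subtrees_trans[of "right v" v T] by (cases v; cases "right v") auto
  then have "\<exists>!z. transition (Tr t) (left_region v) (right_region v) z"
    using tree_invariant[OF assms(1)] v convex_in_left_region[OF bst v] convex_in_subtree[OF bst]
      regions_union[OF v(2)] regions_disjoint[OF bst_subtrees[OF v(1) bst] v(2)]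
      full_inner_node[OF full assms(2)]
    by (intro transition_ex1) (auto simp: right_region_def left_region_def)
  then show ?thesis unfolding transition_point_def by (metis theI')
qed

lemma inj_transition_point:
  assumes "t \<le> length X"
  shows "inj_on (transition_point (Tr t)) (inner_nodes T)"
proof (rule inj_onI, rule ccontr)
  fix u v assume uv: "u \<in> inner_nodes T" "v \<in> inner_nodes T" "u \<noteq> v"
    "transition_point (Tr t) u = transition_point (Tr t) v"
  define z where "z = transition_point (Tr t) v"
  have u: "u \<in> subtrees T" "u \<noteq> Leaf" and v: "v \<in> subtrees T" "v \<noteq> Leaf"
    using uv by (auto simp: inner_nodes_def)
  have tu: "transition (Tr t) (left_region u) (right_region u) z"
    and tv: "transition (Tr t) (left_region v) (right_region v) z"
    using transition_iff[OF assms] uv by (auto simp: z_def)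
  have "z \<in> set_tree u" "z \<in> set_tree v"
    using tu tv regions_union[OF u(2)] regions_union[OF v(2)] by (auto simp: transition_def)
  then have "u \<in> subtrees v \<or> v \<in> subtrees u" using subtrees_comparable[OF bst u(1) v(1)] by blast
  then show False
  proof
    assume "u \<in> subtrees v"
    then show False
      using transition_nested[OF tv tu] inner_node_child_region[of u v] uv(3) u(2)
        regions_union[OF u(2)] regions_disjoint[OF bst_subtrees[OF v(1) bst] v(2)] by auto
  next
    assume "v \<in> subtrees u"
    then show False
      using transition_nested[OF tu tv] inner_node_child_region[of v u] uv(3) v(2)
        regions_union[OF v(2)] regions_disjoint[OF bst_subtrees[OF u(1) bst] u(2)] by auto
  qed
qed

definition touch_times :: "nat tree \<Rightarrow> nat set" where
  "touch_times v = {t \<in> {..<length X}. transition_point (Tr t) v \<in> touched (Tr t) (X ! t) (es t)}"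

text \<open>The root of the current tree is touched in every step and is never a transition point.\<close>

lemma touched_transition_points:
  assumes "t < length X" "T \<noteq> Leaf"
  shows "Suc (card {v \<in> inner_nodes T. transition_point (Tr t) v \<in> touched (Tr t) (X ! t) (es t)})
    \<le> card (touched (Tr t) (X ! t) (es t))" (is "Suc (card ?V) \<le> card ?Q")
proof -
  have inv: "bst (Tr t)" "set_tree (Tr t) = set_tree T" using tree_invariant assms by auto
  then obtain l a r where tr: "Tr t = Node l a r" using assms(2) by (cases "Tr t") auto
  have "rots (Tr t) (es t) (Tr (Suc t))" using run assms(1) by (simp add: valid_run_def)
  then have "endpoints (es t) \<subseteq> set_tree (Tr t)" using rots_invariants inv by blast
  then have "?Q \<subseteq> set_tree (Tr t)"
    using steiner_subset path_keys_subset by (simp add: touched_def)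
  then have fin: "finite ?Q" by (rule finite_subset) simp
  have a: "a \<in> ?Q" by (simp add: touched_def tr)
  have "transition_point (Tr t) v \<noteq> a" if "v \<in> inner_nodes T" for v
  proof (rule transition_not_root)
    show "transition (Node l a r) (left_region v) (right_region v) (transition_point (Tr t) v)"
      using transition_iff[of t v] that assms(1) tr by simp
    show "left_region v \<union> right_region v \<subseteq> set_tree (Node l a r)"
      using that inv(2) tr regions_union[of v] set_tree_subtrees[of v T] by (auto simp: inner_nodes_def)
  qed
  then have "transition_point (Tr t) ` ?V \<subseteq> ?Q - {a}" by auto
  moreover have "inj_on (transition_point (Tr t)) ?V"
    by (rule inj_on_subset[OF inj_transition_point]) (use assms(1) in auto)
  ultimately have "card ?V \<le> card (?Q - {a})" using fin card_inj_on_le by blast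
  then show ?thesis using fin a card_Suc_Diff1[OF fin a] by simp
qed

lemma run_cost_ge:
  assumes "T \<noteq> Leaf"
  shows "length X + (\<Sum>v\<in>inner_nodes T. card (touch_times v)) \<le> run_cost X Tr es"
proof -
  have "length X + (\<Sum>v\<in>inner_nodes T. card (touch_times v)) =
      (\<Sum>t<length X. Suc (card {v \<in> inner_nodes T.
        transition_point (Tr t) v \<in> touched (Tr t) (X ! t) (es t)}))"
    unfolding touch_times_def sum_card_swap[OF finite_lessThan finite_inner_nodes, symmetric]
    by (simp add: sum_Suc)
  also have "\<dots> \<le> (\<Sum>t<length X. card (touched (Tr t) (X ! t) (es t)))"
    using touched_transition_points assms by (intro sum_mono) auto
  finally show ?thesis by (simp add: run_cost_def step_cost_def touched_def)
qed

text \<open>If the transition point went untouched throughout, it would remain one fixed key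
  \<open>z\<close>, because only rotations at \<open>z\<close> change what is below it. This
  \<open>z\<close> tops one of the two regions, and the query to that region must pass through it.
  The argument does not depend on which of the two queries comes first.\<close>

lemma touch_between:
  assumes v: "v \<in> inner_nodes T" and t: "a \<le> t1" "t1 \<le> b" "a \<le> t2" "t2 \<le> b" "b < length X"
    and q: "X ! t1 \<in> left_region v" "X ! t2 \<in> right_region v"
  shows "\<exists>t\<in>touch_times v. a \<le> t \<and> t \<le> b"
proof (rule ccontr)
  assume no: "\<not> ?thesis"
  define z where "z = transition_point (Tr a) v"
  have nt: "transition_point (Tr t) v \<notin> touched (Tr t) (X ! t) (es t)" if "a \<le> t" "t \<le> b" for t
    using no that t(5) by (auto simp: touch_times_def)
  have const: "a \<le> c \<Longrightarrow> c \<le> b \<Longrightarrow> transition (Tr c) (left_region v) (right_region v) z" for c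
  proof (induction c rule: dec_induct)
    case base
    then show ?case using transition_iff[of a v] v t z_def by simp
  next
    case (step c)
    then have tc: "transition (Tr c) (left_region v) (right_region v) z" by simp
    then have "z = transition_point (Tr c) v" using transition_iff[of c v] v t(5) step by simp
    then have "z \<notin> touched (Tr c) (X ! c) (es c)" using nt[of c] step by simp
    then have "z \<notin> endpoints (es c)" using steiner_superset by (auto simp: touched_def)
    moreover have "rots (Tr c) (es c) (Tr (Suc c))" using run step t(5) by (simp add: valid_run_def)
    moreover have "bst (Tr c)" using tree_invariant[of c] step t(5) by simp
    ultimately show ?case using transition_cong[OF tc] keys_below_rots by blast
  qed
  have path: "z \<notin> path_keys (X ! c) (Tr c)" if "a \<le> c" "c \<le> b" for c
    using nt[OF that] const[OF that] transition_iff[of c v] v t(5) that by (auto simp: touched_def)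
  show False
    using const[OF t(1,2)] const[OF t(3,4)] path[OF t(1,2)] path[OF t(3,4)] q
      regions_disjoint[OF bst_subtrees[OF _ bst], of v] v
    unfolding transition_def keys_below_def inner_nodes_def by blast
qed

end

section \<open>Counting touches in stable sequences\<close>

definition query_count :: "nat list \<Rightarrow> nat tree \<Rightarrow> nat" where
  "query_count X v = card {t \<in> {..<length X}. X ! t \<in> set_tree v}"

definition query_times :: "nat list \<Rightarrow> nat tree \<Rightarrow> nat list" where
  "query_times X v = filter (\<lambda>t. X ! t \<in> set_tree v) [0..<length X]"

lemma subseq_in_eq_map: "subseq_in v X = map ((!) X) (query_times X v)"
proof -
  have "subseq_in v X = filter (\<lambda>x. x \<in> set_tree v) (map ((!) X) [0..<length X])"
    unfolding subseq_in_def by (simp only: map_nth)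
  also have "\<dots> = map ((!) X) (query_times X v)"
    unfolding query_times_def filter_map by (simp add: comp_def)
  finally show ?thesis .
qed

lemma length_query_times: "length (query_times X v) = query_count X v"
proof -
  have "distinct (query_times X v)" by (simp add: query_times_def)
  then have "length (query_times X v) = card (set (query_times X v))" by (simp add: distinct_card)
  also have "set (query_times X v) = {t \<in> {..<length X}. X ! t \<in> set_tree v}"
    by (auto simp: query_times_def)
  finally show ?thesis by (simp add: query_count_def)
qed

lemma length_subseq_in: "length (subseq_in v X) = query_count X v"
  by (simp add: subseq_in_eq_map length_query_times)

lemma sorted_query_times: "sorted_wrt (<) (query_times X v)"
  unfolding query_times_def by (intro sorted_wrt_filter) simp

lemma nth_query_times:
  assumes "i < query_count X v"
  shows "query_times X v ! i < length X"
proof -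
  have "query_times X v ! i \<in> set (query_times X v)" using assms by (simp add: length_query_times)
  then show ?thesis by (simp add: query_times_def)
qed

text \<open>Consecutive blocks of \<open>w\<close> entries occupy disjoint time spans, so choosing
  one element of \<open>B\<close> per block is injective. An incomplete last block is discarded,
  hence \<open>div\<close>.\<close>

lemma windows_le_card:
  fixes ts :: "nat list"
  assumes "finite B" "sorted_wrt (<) ts"
    and "\<And>i. i < length ts div w \<Longrightarrow> \<exists>t\<in>B. ts ! (w * i) \<le> t \<and> t \<le> ts ! (w * i + (w - 1))"
  shows "length ts div w \<le> card B"
proof -
  obtain b where b: "\<And>i. i < length ts div w \<Longrightarrow>
      b i \<in> B \<and> ts ! (w * i) \<le> b i \<and> b i \<le> ts ! (w * i + (w - 1))"
    using assms(3) by metis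
  have lt: "b i < b j" if "i < j" "j < length ts div w" for i j
  proof -
    have w: "0 < w" using that(2) by (cases w) auto
    have "w * Suc i \<le> w * j" using that(1) by (intro mult_le_mono2) simp
    then have i: "w * i + (w - 1) < w * j" using w by simp
    have "w * Suc j \<le> w * (length ts div w)" using that(2) by (intro mult_le_mono2) simp
    also have "\<dots> \<le> length ts" by simp
    finally have "w * j < length ts" using w by simp
    then have "ts ! (w * i + (w - 1)) < ts ! (w * j)"
      using sorted_wrt_nth_less[OF assms(2) i] by simp
    then show ?thesis using b[of i] b[of j] that by force
  qed
  have "inj_on b {..<length ts div w}"
    by (rule linorder_inj_onI) (use lt in \<open>force simp: linorder_neq_iff\<close>)+
  moreover have "b ` {..<length ts div w} \<subseteq> B" using b by auto
  ultimately show ?thesis using card_inj_on_le[OF _ _ assms(1)] by force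
qed

section \<open>Blocks of queries and the touches they force\<close>

lemma cyclic3_window:
  assumes "cyclic3 A B C Y" "i < length Y div 3" "Z \<in> {A, B, C}"
  shows "\<exists>j. 3 * i \<le> j \<and> j \<le> 3 * i + 2 \<and> j < length Y \<and> Y ! j \<in> set_tree Z"
proof -
  from assms(1) obtain p where p: "p < 3"
    "\<And>j. j < length Y \<Longrightarrow> Y ! j \<in> set_tree ([A, B, C] ! ((j + p) mod 3))"
    by (auto simp: cyclic3_def)
  obtain k where k: "k < 3" "[A, B, C] ! k = Z"
    using assms(3) by (auto intro: that[of 0] that[of 1] that[of 2])
  \<comment> \<open>Position \<open>j\<close> carries slot \<open>(j + p) mod 3\<close>; the offset
    inside the block is therefore \<open>k - p\<close> modulo 3.\<close>
  define j where "j = 3 * i + (if p \<le> k then k - p else k + 3 - p)"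
  have "j + p = k + 3 * i \<or> j + p = k + 3 * (i + 1)" using p(1) by (auto simp: j_def)
  then have jk: "(j + p) mod 3 = k" using k(1) by (metis mod_less mod_mult_self2)
  have j: "3 * i \<le> j" "j \<le> 3 * i + 2" using k(1) by (auto simp: j_def)
  then have "j < length Y" using assms(2) by linarith
  then show ?thesis using p(2)[of j] jk k(2) j by auto
qed

text \<open>Applied later to the part outside the favored child: a third of the queries there leaves
  at most two thirds for the favored child.\<close>

lemma query_count_third:
  assumes "cyclic3 A B C (subseq_in v X)" "Z \<in> {A, B, C}"
  shows "query_count X v div 3 \<le> query_count X Z"
proof -
  let ?ts = "query_times X v"
  have "length ?ts div 3 \<le> card {t \<in> {..<length X}. X ! t \<in> set_tree Z}"
  proof (rule windows_le_card[OF _ sorted_query_times])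
    fix i assume i: "i < length ?ts div 3"
    then obtain j where j: "3 * i \<le> j" "j \<le> 3 * i + 2" "j < length ?ts" "X ! (?ts ! j) \<in> set_tree Z"
      using cyclic3_window[OF assms(1), of i Z] assms(2) by (auto simp: subseq_in_eq_map)
    moreover have "3 * i + 2 < length ?ts" using i by linarith
    ultimately have "?ts ! (3 * i) \<le> ?ts ! j" "?ts ! j \<le> ?ts ! (3 * i + 2)"
      using sorted_wrt_nth_less[OF sorted_query_times, of _ _ X v] by (metis nat_less_le order.refl)+
    then show "\<exists>t\<in>{t \<in> {..<length X}. X ! t \<in> set_tree Z}. ?ts ! (3 * i) \<le> t \<and> t \<le> ?ts ! (3 * i + (3 - 1))"
      using j nth_query_times[of j X v] by (auto simp: length_query_times)
  qed simp
  then show ?thesis by (simp add: length_query_times query_count_def)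
qed

context bst_run
begin

lemma finite_touch_times: "finite (touch_times v)"
  by (simp add: touch_times_def)

text \<open>The blocks consist of queries to \<open>v\<close> even when touches of another node
  \<open>u\<close> are counted. A block meets all three parts, so it forces a touch for
  \<open>v\<close> and one for its favored child alike.\<close>

lemma touch_times_cyclic3:
  assumes "cyclic3 A B C (subseq_in v X)" "Z \<in> {A, B, C}" "Z' \<in> {A, B, C}"
    and "u \<in> inner_nodes T" "set_tree Z \<subseteq> left_region u" "set_tree Z' \<subseteq> right_region u"
  shows "query_count X v div 3 \<le> card (touch_times u)"
proof -
  let ?ts = "query_times X v"
  have "length ?ts div 3 \<le> card (touch_times u)"
  proof (rule windows_le_card[OF finite_touch_times sorted_query_times])
    fix i assume i: "i < length ?ts div 3"
    then obtain j where j: "3 * i \<le> j" "j \<le> 3 * i + 2" "j < length ?ts" "X ! (?ts ! j) \<in> set_tree Z"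
      using cyclic3_window[OF assms(1), of i Z] assms(2) by (auto simp: subseq_in_eq_map)
    from i obtain k where k: "3 * i \<le> k" "k \<le> 3 * i + 2" "k < length ?ts" "X ! (?ts ! k) \<in> set_tree Z'"
      using cyclic3_window[OF assms(1), of i Z'] assms(3) by (auto simp: subseq_in_eq_map)
    have len: "3 * i + 2 < length ?ts" using i by linarith
    have mono: "?ts ! a \<le> ?ts ! b" if "a \<le> b" "b < length ?ts" for a b
      using sorted_wrt_nth_less[OF sorted_query_times, of a b X v] that by (cases "a = b") auto
    have "\<exists>t\<in>touch_times u. ?ts ! (3 * i) \<le> t \<and> t \<le> ?ts ! (3 * i + 2)"
    proof (rule touch_between[OF assms(4)])
      show "?ts ! (3 * i) \<le> ?ts ! j" "?ts ! j \<le> ?ts ! (3 * i + 2)"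
        "?ts ! (3 * i) \<le> ?ts ! k" "?ts ! k \<le> ?ts ! (3 * i + 2)"
        using j k len by (auto intro!: mono)
      show "?ts ! (3 * i + 2) < length X"
        using nth_query_times[of "3 * i + 2" X v] len by (simp add: length_query_times)
    qed (use j k assms(5,6) in auto)
    then show "\<exists>t\<in>touch_times u. ?ts ! (3 * i) \<le> t \<and> t \<le> ?ts ! (3 * i + (3 - 1))" by simp
  qed
  then show ?thesis by (simp add: length_query_times)
qed

lemma query_in_regions:
  assumes "leaf_queries T X" "v \<in> inner_nodes T" "i < query_count X v"
  shows "subseq_in v X ! i \<in> set_tree (left v) \<or> subseq_in v X ! i \<in> set_tree (right v)"
proof -
  have "subseq_in v X ! i \<in> set (subseq_in v X)" using assms(3) by (simp add: length_subseq_in)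
  then have "leaf_key T (subseq_in v X ! i)" "subseq_in v X ! i \<in> set_tree v"
    using assms(1) by (auto simp: subseq_in_def leaf_queries_def)
  then show ?thesis using leaf_key_in_inner[OF bst assms(2)] by blast
qed

lemma strongly_stable_alternates:
  assumes "leaf_queries T X" "v \<in> inner_nodes T" "strongly_stable_node v X" "Suc i < query_count X v"
  shows "subseq_in v X ! i \<in> set_tree (left v) \<and> subseq_in v X ! Suc i \<in> set_tree (right v) \<or>
    subseq_in v X ! i \<in> set_tree (right v) \<and> subseq_in v X ! Suc i \<in> set_tree (left v)"
proof -
  have "subseq_in v X ! i \<in> set_tree (left v) \<longleftrightarrow> subseq_in v X ! Suc i \<in> set_tree (right v)"
    using assms(3,4) by (auto simp: strongly_stable_node_def Let_def length_subseq_in)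
  then show ?thesis
    using query_in_regions[OF assms(1,2), of i] query_in_regions[OF assms(1,2), of "Suc i"] assms(4)
    by auto
qed

lemma touch_times_strong:
  assumes "leaf_queries T X" "v \<in> inner_nodes T" "strongly_stable_node v X"
  shows "query_count X v div 2 \<le> card (touch_times v)"
proof -
  let ?ts = "query_times X v"
  have "length ?ts div 2 \<le> card (touch_times v)"
  proof (rule windows_le_card[OF finite_touch_times sorted_query_times])
    fix i assume "i < length ?ts div 2"
    then have len: "Suc (2 * i) < length ?ts" by linarith
    then have le: "?ts ! (2 * i) \<le> ?ts ! Suc (2 * i)"
      using sorted_wrt_nth_less[OF sorted_query_times, of "2 * i" "Suc (2 * i)" X v] by simp
    have m: "?ts ! Suc (2 * i) < length X"
      using nth_query_times[of "Suc (2 * i)" X v] len by (simp add: length_query_times)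
    have "X ! (?ts ! (2 * i)) \<in> set_tree (left v) \<and> X ! (?ts ! Suc (2 * i)) \<in> set_tree (right v) \<or>
        X ! (?ts ! (2 * i)) \<in> set_tree (right v) \<and> X ! (?ts ! Suc (2 * i)) \<in> set_tree (left v)"
      using strongly_stable_alternates[OF assms, of "2 * i"] len
      by (simp add: subseq_in_eq_map length_query_times)
    then have "\<exists>t\<in>touch_times v. ?ts ! (2 * i) \<le> t \<and> t \<le> ?ts ! Suc (2 * i)"
      using touch_between[OF assms(2) order.refl le le order.refl m]
        touch_between[OF assms(2) le order.refl order.refl le m]
      by (auto simp: left_region_def right_region_def)
    then show "\<exists>t\<in>touch_times v. ?ts ! (2 * i) \<le> t \<and> t \<le> ?ts ! (2 * i + (2 - 1))" by simp
  qed
  then show ?thesis by (simp add: length_query_times)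
qed

end

section \<open>Comparing the two costs\<close>

lemma inner_nodes_Node:
  "inner_nodes (Node l a r) = (if l = Leaf then {} else {Node l a r}) \<union> inner_nodes l \<union> inner_nodes r"
  by (auto simp: inner_nodes_def)

text \<open>\<open>inner_nodes\<close> is a set of tree values, so equal subtrees would be counted
  once. Distinct keys rule this out.\<close>

lemma sum_inner_nodes:
  assumes "bst (Node l a r)" "l \<noteq> Leaf"
  shows "sum h (inner_nodes (Node l a r)) = h (Node l a r) + (sum h (inner_nodes l) + sum h (inner_nodes r))"
proof -
  have "set_tree l \<inter> set_tree r = {}" using assms(1) by (rule bst_disjoint)
  moreover have "set_tree v \<subseteq> set_tree l" "set_tree v \<noteq> {}" if "v \<in> inner_nodes l" for v
    using that set_tree_subtrees by (auto simp: inner_nodes_def)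
  moreover have "set_tree v \<subseteq> set_tree r" if "v \<in> inner_nodes r" for v
    using that set_tree_subtrees by (auto simp: inner_nodes_def)
  ultimately have "inner_nodes l \<inter> inner_nodes r = {}" by blast
  moreover have "Node l a r \<notin> inner_nodes l \<union> inner_nodes r"
    using assms(1) set_tree_subtrees[of "Node l a r" l] set_tree_subtrees[of "Node l a r" r]
    by (auto simp: inner_nodes_def)
  ultimately show ?thesis
    using assms(2) by (simp add: inner_nodes_Node finite_inner_nodes sum.union_disjoint)
qed

lemma inner_nodes_Leaf: "inner_nodes Leaf = {}"
  by (auto simp: inner_nodes_def)

lemma inner_nodes_trivial: "full (Node Leaf a r) \<Longrightarrow> inner_nodes (Node Leaf a r) = {}"
  by (auto simp: inner_nodes_def)

text \<open>All proper ancestors of a leaf are inner nodes; the successor accounts for the leaf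
  itself.\<close>

lemma card_path_keys:
  assumes "bst T" "full T" "leaf_key T x"
  shows "card (path_keys x T) = Suc (card {v \<in> inner_nodes T. x \<in> set_tree v})"
  using assms
proof (induction T)
  case (Node l a r)
  show ?case
  proof (cases "l = Leaf")
    case True
    then have "r = Leaf" using Node.prems(2) by simp
    then show ?thesis using True Node.prems by (simp add: leaf_key_def inner_nodes_trivial)
  next
    case False
    have count: "card {v \<in> inner_nodes (Node l a r). x \<in> set_tree v} =
        (\<Sum>v\<in>inner_nodes (Node l a r). if x \<in> set_tree v then 1 else 0)"
      "card {v \<in> inner_nodes l. x \<in> set_tree v} = (\<Sum>v\<in>inner_nodes l. if x \<in> set_tree v then 1 else 0)"
      "card {v \<in> inner_nodes r. x \<in> set_tree v} = (\<Sum>v\<in>inner_nodes r. if x \<in> set_tree v then 1 else 0)"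
      by (simp_all add: sum.If_cases finite_inner_nodes Int_def)
    have split: "card {v \<in> inner_nodes (Node l a r). x \<in> set_tree v} =
        (if x \<in> set_tree (Node l a r) then 1 else 0) +
        (card {v \<in> inner_nodes l. x \<in> set_tree v} + card {v \<in> inner_nodes r. x \<in> set_tree v})"
      unfolding count by (rule sum_inner_nodes[OF Node.prems(1) False])
    have finite: "finite (path_keys x S)" for S
      using path_keys_subset finite_set_tree by (rule finite_subset)
    have none: "card {v \<in> inner_nodes S. x \<in> set_tree v} = 0" if "x \<notin> set_tree S" for S
    proof -
      have "{v \<in> inner_nodes S. x \<in> set_tree v} = {}"
        using that set_tree_subtrees by (auto simp: inner_nodes_def)
      then show ?thesis by (simp only: card.empty)
    qed
    consider "leaf_key l x" | "leaf_key r x"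
      using Node.prems(3) False by (auto simp: leaf_key_def)
    then show ?thesis
    proof cases
      case 1
      then have "x \<in> set_tree l" by (rule leaf_key_in_tree)
      moreover from this have "x < a" "x \<notin> set_tree r"
        using Node.prems(1) by (auto dest: order.strict_trans)
      moreover have "a \<notin> path_keys x l" using path_keys_subset[of x l] Node.prems(1) by auto
      ultimately show ?thesis using Node.IH(1) Node.prems(1,2) 1 finite none[of r] split by simp
    next
      case 2
      then have "x \<in> set_tree r" by (rule leaf_key_in_tree)
      moreover from this have "a < x" "x \<notin> set_tree l"
        using Node.prems(1) by (auto dest: order.strict_trans)
      moreover from this have "path_keys x (Node l a r) = insert a (path_keys x r)" by simp
      moreover have "a \<notin> path_keys x r" using path_keys_subset[of x r] Node.prems(1) by auto
      ultimately show ?thesis using Node.IH(2) Node.prems(1,2) 2 finite none[of l] split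
        by (simp del: path_keys.simps)
    qed
  qed
qed (simp add: leaf_key_def)

lemma sum_card_path_keys:
  assumes "bst T" "full T" "leaf_queries T X"
  shows "(\<Sum>t<length X. card (path_keys (X ! t) T)) =
    length X + (\<Sum>v\<in>inner_nodes T. query_count X v)"
proof -
  have "(\<Sum>t<length X. card (path_keys (X ! t) T)) =
      (\<Sum>t<length X. Suc (card {v \<in> inner_nodes T. X ! t \<in> set_tree v}))"
    using assms by (intro sum.cong) (auto simp: leaf_queries_def card_path_keys)
  also have "\<dots> = length X + (\<Sum>v\<in>inner_nodes T. query_count X v)"
    unfolding query_count_def sum_card_swap[OF finite_lessThan finite_inner_nodes, symmetric]
    by (simp add: sum_Suc)
  finally show ?thesis .
qed

section \<open>Divisibility of query counts from doubling the sequence\<close>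

lemma alternating_append_self:
  assumes "\<And>x. x \<in> set Y \<Longrightarrow> x \<in> L \<longleftrightarrow> x \<notin> R"
    and "\<And>i. Suc i < length (Y @ Y) \<Longrightarrow> (Y @ Y) ! i \<in> L \<longleftrightarrow> (Y @ Y) ! Suc i \<in> R"
  shows "even (length Y)"
proof (rule ccontr)
  assume odd: "odd (length Y)"
  have "i < length (Y @ Y) \<Longrightarrow> (Y @ Y) ! i \<in> L \<longleftrightarrow> (even i \<longleftrightarrow> (Y @ Y) ! 0 \<in> L)" for i
  proof (induction i)
    case (Suc i)
    have "(Y @ Y) ! Suc i \<in> set (Y @ Y)" using Suc.prems by (rule nth_mem)
    then have "(Y @ Y) ! Suc i \<in> L \<longleftrightarrow> (Y @ Y) ! Suc i \<notin> R" using assms(1) by auto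
    then show ?case using Suc assms(2)[of i] by auto
  qed simp
  \<comment> \<open>Position \<open>length Y\<close> repeats the first entry, but after an odd
    number of alternations it should lie on the other side.\<close>
  from this[of "length Y"] show False using odd by (cases Y) (auto simp: nth_append)
qed

lemma cyclic3_append_self:
  assumes "cyclic3 A B C (Y @ Y)" "set_tree A \<inter> set_tree B = {}" "set_tree B \<inter> set_tree C = {}"
    "set_tree A \<inter> set_tree C = {}"
  shows "cyclic3 A B C Y \<and> 3 dvd length Y"
proof -
  from assms(1) obtain p where p: "p < 3"
    "\<And>i. i < length (Y @ Y) \<Longrightarrow> (Y @ Y) ! i \<in> set_tree ([A, B, C] ! ((i + p) mod 3))"
    unfolding cyclic3_def by blast
  have "Y ! i \<in> set_tree ([A, B, C] ! ((i + p) mod 3))" if "i < length Y" for i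
    using p(2)[of i] that by (simp add: nth_append)
  then have "cyclic3 A B C Y" using p(1) unfolding cyclic3_def by blast
  moreover have "3 dvd length Y"
  proof (cases "Y = []")
    case False
    have slot: "a = b" if "a < 3" "b < 3" "k \<in> set_tree ([A, B, C] ! a)" "k \<in> set_tree ([A, B, C] ! b)"
      for a b k
    proof -
      have "a = 0 \<or> a = 1 \<or> a = 2" "b = 0 \<or> b = 1 \<or> b = 2" using that by auto
      then show ?thesis using that(3,4) assms(2-4) by auto
    qed
    \<comment> \<open>The first entry recurs at position \<open>length Y\<close>; the three parts
      are disjoint, so both positions carry the same slot.\<close>
    have "Y ! 0 \<in> set_tree ([A, B, C] ! (p mod 3))"
      "Y ! 0 \<in> set_tree ([A, B, C] ! ((length Y + p) mod 3))"
      using p(2)[of 0] p(2)[of "length Y"] False by (auto simp: nth_append)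
    then have "(length Y + p) mod 3 = (0 + p) mod 3" using slot by simp
    then show ?thesis by (metis add_diff_cancel_right' mod_eq_dvd_iff_nat add_0 le_add2)
  qed simp
  ultimately show ?thesis by blast
qed

text \<open>The pattern at each node has to close up at the seam between the two copies, so the
  number of queries is a multiple of its period. Then the divisions by 2 and 3 in the touch bounds
  lose nothing.\<close>

lemma stable_node_append_self:
  assumes "bst T" "mixed_stable T (X @ X)" "v \<in> inner_nodes T"
  shows "strongly_stable_node v X \<and> even (query_count X v) \<or>
    weakly_stable_left v X \<and> 3 dvd query_count X v \<or>
    weakly_stable_right v X \<and> 3 dvd query_count X v"
proof -
  have v: "v \<in> subtrees T" "v \<noteq> Leaf" "left v \<noteq> Leaf" using assms(3) by (auto simp: inner_nodes_def)
  have bv: "bst v" using bst_subtrees v(1) assms(1) by blast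
  define Y where "Y = subseq_in v X"
  have YY: "subseq_in v (X @ X) = Y @ Y" by (simp add: Y_def subseq_in_def)
  have len: "query_count X v = length Y" by (simp add: Y_def length_subseq_in)
  have "strongly_stable_node v (X @ X) \<or> weakly_stable_left v (X @ X) \<or> weakly_stable_right v (X @ X)"
    using assms(2,3) by (simp add: mixed_stable_def)
  then show ?thesis
  proof (elim disjE)
    assume s: "strongly_stable_node v (X @ X)"
    then have alt: "Suc i < length (Y @ Y) \<Longrightarrow>
        (Y @ Y) ! i \<in> set_tree (left v) \<longleftrightarrow> (Y @ Y) ! Suc i \<in> set_tree (right v)" for i
      unfolding strongly_stable_node_def Let_def YY by blast
    have "Y ! i \<in> set_tree (left v) \<longleftrightarrow> Y ! Suc i \<in> set_tree (right v)" if "Suc i < length Y" for i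
      using alt[of i] that by (simp add: nth_append)
    then have "strongly_stable_node v X" unfolding strongly_stable_node_def Let_def Y_def by blast
    moreover have "even (length Y)"
    proof (rule alternating_append_self[OF _ alt])
      fix x assume "x \<in> set Y"
      then have "x \<in> set_tree v" "leaf_key T x"
        using assms(2) by (auto simp: Y_def subseq_in_def mixed_stable_def leaf_queries_def)
      then have "x \<in> set_tree (left v) \<or> x \<in> set_tree (right v)"
        using leaf_key_in_inner[OF assms(1,3)] by blast
      moreover have "set_tree (left v) \<inter> set_tree (right v) = {}"
        using bv by (cases v) (auto dest: order.strict_trans)
      ultimately show "x \<in> set_tree (left v) \<longleftrightarrow> x \<notin> set_tree (right v)" by blast
    qed
    ultimately show ?thesis using len by simp
  next
    assume w: "weakly_stable_left v (X @ X)"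
    then obtain A b B a C where vv: "v = Node (Node A b B) a C" "A \<noteq> Leaf" "cyclic3 A B C (Y @ Y)"
      using weakly_stable_leftE v(2) YY by metis
    moreover have "set_tree A \<inter> set_tree B = {}" "set_tree B \<inter> set_tree C = {}" "set_tree A \<inter> set_tree C = {}"
      using bv bst_disjoint[of A b B] bst_disjoint[of "Node A b B" a C] unfolding vv(1) by auto
    ultimately have "cyclic3 A B C Y \<and> 3 dvd length Y" using cyclic3_append_self by blast
    then have "weakly_stable_left v X \<and> 3 dvd query_count X v"
      using vv(1,2) len by (auto simp: weakly_stable_left_def Let_def Y_def)
    then show ?thesis by blast
  next
    assume w: "weakly_stable_right v (X @ X)"
    then obtain A b B a C where vv: "v = Node C a (Node B b A)" "B \<noteq> Leaf" "cyclic3 A B C (Y @ Y)"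
      using weakly_stable_rightE v(2) YY by metis
    moreover have "set_tree A \<inter> set_tree B = {}" "set_tree B \<inter> set_tree C = {}" "set_tree A \<inter> set_tree C = {}"
      using bv bst_disjoint[of B b A] bst_disjoint[of C a "Node B b A"] unfolding vv(1) by auto
    ultimately have "cyclic3 A B C Y \<and> 3 dvd length Y" using cyclic3_append_self by blast
    then have "weakly_stable_right v X \<and> 3 dvd query_count X v"
      using vv(1,2) len by (auto simp: weakly_stable_right_def Let_def Y_def)
    then show ?thesis by blast
  qed
qed

lemma query_count_inner:
  assumes "bst T" "leaf_queries T X" "v \<in> inner_nodes T"
  shows "query_count X v = query_count X (left v) + query_count X (right v)"
proof -
  have v: "v \<in> subtrees T" "v \<noteq> Leaf" using assms(3) by (auto simp: inner_nodes_def)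
  have "bst v" using bst_subtrees v(1) assms(1) by blast
  then have disj: "set_tree (left v) \<inter> set_tree (right v) = {}"
    by (cases v) (auto dest: order.strict_trans)
  have sub: "set_tree (left v) \<union> set_tree (right v) \<subseteq> set_tree v" using v(2) by (cases v) auto
  have "X ! t \<in> set_tree v \<longleftrightarrow> X ! t \<in> set_tree (left v) \<union> set_tree (right v)" if "t < length X" for t
    using leaf_key_in_inner[OF assms(1,3), of "X ! t"] assms(2) that sub
    by (auto simp: leaf_queries_def)
  then have "{t \<in> {..<length X}. X ! t \<in> set_tree v} =
      {t \<in> {..<length X}. X ! t \<in> set_tree (left v)} \<union> {t \<in> {..<length X}. X ! t \<in> set_tree (right v)}"
    by auto
  then show ?thesis unfolding query_count_def
    using disj by (simp add: card_Un_disjoint disjoint_iff)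
qed

text \<open>A node may be undercharged as long as the deficit is paid by one of its children; since
  a node has a single parent, none pays twice.\<close>

lemma sum_inner_nodes_weak:
  fixes c g :: "nat tree \<Rightarrow> nat"
  assumes "bst T" "full T"
    and "\<And>v. v \<in> inner_nodes T \<Longrightarrow> c v \<le> 2 * g v \<or>
      (\<exists>u\<in>inner_nodes T. (u = left v \<or> u = right v) \<and> 2 * c v + 2 * c u \<le> 5 * g v + 5 * g u)"
  shows "2 * sum c (inner_nodes T) \<le> 5 * sum g (inner_nodes T)"
proof -
  \<comment> \<open>The second conjunct is the same bound with the root of \<open>S\<close> left out
    on both sides. It allows the parent to claim that root for its own inequality while the rest of
    \<open>S\<close> stays balanced.\<close>
  have "2 * sum c (inner_nodes S) \<le> 5 * sum g (inner_nodes S) \<and> (S \<in> inner_nodes S \<longrightarrow>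
      2 * sum c (inner_nodes S) + 5 * g S \<le> 5 * sum g (inner_nodes S) + 2 * c S)"
    if "S \<in> subtrees T" for S
    using that
  proof (induction S)
    case (Node l a r)
    have S: "bst (Node l a r)" "full (Node l a r)"
      using bst_subtrees full_subtrees Node.prems assms(1,2) by blast+
    have sub: "l \<in> subtrees T" "r \<in> subtrees T"
      using subtrees_trans[OF _ Node.prems] by (cases l; auto; cases r; auto)+
    show ?case
    proof (cases "l = Leaf")
      case True
      then show ?thesis using inner_nodes_trivial S(2) by simp
    next
      case False
      then have inner: "Node l a r \<in> inner_nodes T" using Node.prems by (simp add: inner_nodes_def)
      note sums = sum_inner_nodes[OF S(1) False]
      note IH = Node.IH(1)[OF sub(1)] Node.IH(2)[OF sub(2)]
      from assms(3)[OF inner] show ?thesis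
      proof
        assume "c (Node l a r) \<le> 2 * g (Node l a r)"
        then show ?thesis using IH unfolding sums by auto
      next
        assume "\<exists>u\<in>inner_nodes T. (u = left (Node l a r) \<or> u = right (Node l a r)) \<and>
          2 * c (Node l a r) + 2 * c u \<le> 5 * g (Node l a r) + 5 * g u"
        then obtain u where u: "u \<in> inner_nodes T" "u = l \<or> u = r"
          "2 * c (Node l a r) + 2 * c u \<le> 5 * g (Node l a r) + 5 * g u" by auto
        have "u \<in> inner_nodes u" using u(1) by (cases u) (auto simp: inner_nodes_def)
        then show ?thesis using IH u(2,3) unfolding sums by auto
      qed
    qed
  qed (simp add: inner_nodes_Leaf)
  from this[OF subtrees_refl] show ?thesis by simp
qed

text \<open>A deficit of one arises only where both children are queried. In a binary tree such
  branchings number at most one less than the queries, so the total deficit stays below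
  \<open>c T\<close>.\<close>

lemma sum_inner_nodes_strong:
  fixes c g :: "nat tree \<Rightarrow> nat"
  assumes "bst T" "full T"
    and "\<And>v. v \<in> inner_nodes T \<Longrightarrow> c v = c (left v) + c (right v)"
    and "\<And>v. v \<in> inner_nodes T \<Longrightarrow> c v \<le> 2 * g v + 1"
    and "\<And>v. v \<in> inner_nodes T \<Longrightarrow> c (left v) = 0 \<or> c (right v) = 0 \<Longrightarrow> c v \<le> 2 * g v"
    and "0 < c T"
  shows "sum c (inner_nodes T) < 2 * sum g (inner_nodes T) + c T"
proof -
  \<comment> \<open>The extra 1 for queried subtrees drives the induction: when both children are
    queried, their two reserves merge into one, and the one set free pays the deficit of the
    node.\<close>
  have "sum c (inner_nodes S) + (if c S = 0 then 0 else 1) \<le> 2 * sum g (inner_nodes S) + c S"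
    if "S \<in> subtrees T" for S
    using that
  proof (induction S)
    case (Node l a r)
    have S: "bst (Node l a r)" "full (Node l a r)"
      using bst_subtrees full_subtrees Node.prems assms(1,2) by blast+
    have sub: "l \<in> subtrees T" "r \<in> subtrees T"
      using subtrees_trans[OF _ Node.prems] by (cases l; auto; cases r; auto)+
    show ?case
    proof (cases "l = Leaf")
      case True
      then show ?thesis using inner_nodes_trivial S(2) by simp
    next
      case False
      then have inner: "Node l a r \<in> inner_nodes T" using Node.prems by (simp add: inner_nodes_def)
      show ?thesis
        using Node.IH(1)[OF sub(1)] Node.IH(2)[OF sub(2)] assms(3-5)[OF inner]
        unfolding sum_inner_nodes[OF S(1) False] by (auto split: if_splits)
    qed
  qed (simp add: inner_nodes_Leaf)
  from this[OF subtrees_refl] show ?thesis using assms(6) by simp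
qed

text \<open>Never rotating is a valid run, so the minimum is over a nonempty set.\<close>

lemma opt_cost_attained:
  obtains Tr es where "valid_run X T Tr es" "opt_cost X T = run_cost X Tr es"
proof -
  have "valid_run X T (\<lambda>_. T) (\<lambda>_. [])" by (simp add: valid_run_def rots_nil)
  then have "\<exists>c Tr es. valid_run X T Tr es \<and> c = run_cost X Tr es" by blast
  from LeastI_ex[OF this] show thesis using that unfolding opt_cost_def by blast
qed

context bst_run
begin

lemma mixed_stable_sum:
  assumes "mixed_stable T (X @ X)"
  shows "2 * (\<Sum>v\<in>inner_nodes T. query_count X v) \<le> 5 * (\<Sum>v\<in>inner_nodes T. card (touch_times v))"
proof (rule sum_inner_nodes_weak[OF bst full])
  fix v assume v: "v \<in> inner_nodes T"
  have lq: "leaf_queries T X" using assms by (auto simp: mixed_stable_def leaf_queries_def)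
  have vT: "v \<in> subtrees T" "v \<noteq> Leaf" using v by (auto simp: inner_nodes_def)
  let ?q = "query_count X v div 3"
  show "query_count X v \<le> 2 * card (touch_times v) \<or>
      (\<exists>u\<in>inner_nodes T. (u = left v \<or> u = right v) \<and>
        2 * query_count X v + 2 * query_count X u \<le> 5 * card (touch_times v) + 5 * card (touch_times u))"
    using stable_node_append_self[OF bst assms v]
  proof (elim disjE conjE)
    assume "strongly_stable_node v X" "even (query_count X v)"
    then show ?thesis using touch_times_strong[OF lq v] by auto
  next
    assume w: "weakly_stable_left v X" and dvd: "3 dvd query_count X v"
    from w vT(2) obtain A b B a C where
      vv: "v = Node (Node A b B) a C" "A \<noteq> Leaf" "cyclic3 A B C (subseq_in v X)"
      by (rule weakly_stable_leftE)
    have u: "left v \<in> inner_nodes T"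
      using subtrees_trans[of "left v" v T] vT(1) vv(1,2) by (auto simp: inner_nodes_def)
    have "?q \<le> card (touch_times v)"
      by (rule touch_times_cyclic3[OF vv(3) _ _ v, of A C])
        (auto simp: vv(1) left_region_def right_region_def)
    moreover have "?q \<le> card (touch_times (left v))"
      by (rule touch_times_cyclic3[OF vv(3) _ _ u, of A B])
        (auto simp: vv(1) left_region_def right_region_def)
    \<comment> \<open>With \<open>3 * ?q\<close> queries to \<open>v\<close>, the favored child gets
      at most \<open>2 * ?q\<close>, and 2 * 3 + 2 * 2 = 10 = 5 + 5 balances against one touch per
      block for each of the two nodes.\<close>
    moreover have "?q \<le> query_count X (right v)"
      by (rule query_count_third[OF vv(3)]) (simp add: vv(1))
    ultimately show ?thesis
      using query_count_inner[OF bst lq v] dvd u by (intro disjI2 bexI[of _ "left v"]) auto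
  next
    assume w: "weakly_stable_right v X" and dvd: "3 dvd query_count X v"
    from w vT(2) obtain A b B a C where
      vv: "v = Node C a (Node B b A)" "B \<noteq> Leaf" "cyclic3 A B C (subseq_in v X)"
      by (rule weakly_stable_rightE)
    have u: "right v \<in> inner_nodes T"
      using subtrees_trans[of "right v" v T] vT(1) vv(1,2) by (auto simp: inner_nodes_def)
    have "?q \<le> card (touch_times v)"
      by (rule touch_times_cyclic3[OF vv(3) _ _ v, of C A])
        (auto simp: vv(1) left_region_def right_region_def)
    moreover have "?q \<le> card (touch_times (right v))"
      by (rule touch_times_cyclic3[OF vv(3) _ _ u, of B A])
        (auto simp: vv(1) left_region_def right_region_def)
    moreover have "?q \<le> query_count X (left v)"
      by (rule query_count_third[OF vv(3)]) (simp add: vv(1))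
    ultimately show ?thesis
      using query_count_inner[OF bst lq v] dvd u by (intro disjI2 bexI[of _ "right v"]) auto
  qed
qed

text \<open>Strong stability of \<open>X\<close> does not extend to \<open>X @ X\<close>: a weakly stable node queried exactly
  three times may look alternating within \<open>X\<close>. Such a node loses half a touch, which the term
  \<open>length X\<close> absorbs.\<close>

lemma strongly_stable_sum:
  assumes "mixed_stable T (X @ X)" "strongly_stable T X" "X \<noteq> []"
  shows "(\<Sum>v\<in>inner_nodes T. query_count X v) <
    2 * (\<Sum>v\<in>inner_nodes T. card (touch_times v)) + length X"
proof -
  have lq: "leaf_queries T X" using assms(2) by (simp add: strongly_stable_def)
  have "X ! t \<in> set_tree T" if "t < length X" for t
    using lq that leaf_key_in_tree by (auto simp: leaf_queries_def)
  then have len: "query_count X T = length X"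
    by (simp add: query_count_def conj_commute cong: conj_cong)
  have half: "query_count X v div 2 \<le> card (touch_times v)" if "v \<in> inner_nodes T" for v
    using touch_times_strong[OF lq that] assms(2) that by (simp add: strongly_stable_def)
  have "sum (query_count X) (inner_nodes T) <
      2 * sum (\<lambda>v. card (touch_times v)) (inner_nodes T) + query_count X T"
  proof (rule sum_inner_nodes_strong[OF bst full])
    fix v assume v: "v \<in> inner_nodes T"
    show split: "query_count X v = query_count X (left v) + query_count X (right v)"
      by (rule query_count_inner[OF bst lq v])
    show "query_count X v \<le> 2 * card (touch_times v) + 1" using half[OF v] by linarith
    assume one: "query_count X (left v) = 0 \<or> query_count X (right v) = 0"
    \<comment> \<open>Two queries to a strongly stable node reach both children, so at most one
      query remains; a single one is impossible, as neither 2 nor 3 divides 1. Hence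
      \<open>v\<close> is not queried at all.\<close>
    have "query_count X v \<le> 1"
    proof (rule ccontr)
      assume "\<not> ?thesis"
      then have ts: "Suc 0 < query_count X v" by simp
      have pos: "0 < query_count X S" if "i < query_count X v" "subseq_in v X ! i \<in> set_tree S" for i S
      proof -
        have "query_times X v ! i \<in> {t \<in> {..<length X}. X ! t \<in> set_tree S}"
          using that nth_query_times[OF that(1)] by (simp add: subseq_in_eq_map length_query_times)
        moreover have "finite {t \<in> {..<length X}. X ! t \<in> set_tree S}" by simp
        ultimately show ?thesis unfolding query_count_def using card_gt_0_iff by blast
      qed
      have "strongly_stable_node v X" using assms(2) v by (simp add: strongly_stable_def)
      from strongly_stable_alternates[OF lq v this ts] show False
        using pos[of 0] pos[of "Suc 0"] ts one by fastforce
    qed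
    moreover have "query_count X v \<noteq> 1"
      using stable_node_append_self[OF bst assms(1) v] by auto
    ultimately show "query_count X v \<le> 2 * card (touch_times v)" by simp
  qed (use len assms(3) in simp)
  then show ?thesis by (simp add: len)
qed

end

theorem theorem5:
  fixes n :: nat and T :: "nat tree" and X :: "nat list"
  assumes "bst T"
    and "set_tree T = {1..n}"
    and "mixed_stable T X"
    and "\<exists>A k. k \<ge> 1 \<and> atomic_seq mixed_stable T X A \<and> X = repeat k A"
  shows "real (gf_cost X T) < 5 / 2 * real (opt_cost X T)
    \<and> (strongly_stable T X \<longrightarrow> real (gf_cost X T) < 2 * real (opt_cost X T))"
proof -
  obtain A k where A: "k \<ge> 1" "A \<noteq> []" "\<And>j. j \<ge> 1 \<Longrightarrow> mixed_stable T (repeat j A)" "X = repeat k A"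
    using assms(4) unfolding atomic_seq_def Let_def by blast
  \<comment> \<open>Stability is assumed for all repetitions of \<open>A\<close>, and
    \<open>X @ X\<close> is one of them.\<close>
  have "repeat (k + k) A = X @ X" by (simp add: A(4) repeat_def replicate_add)
  then have XX: "mixed_stable T (X @ X)" using A(3)[of "k + k"] A(1) by simp
  have "X \<noteq> []" using A(1,2,4) by (cases k) (auto simp: repeat_def)
  have full: "full T" and lq: "leaf_queries T X" using assms(3) by (auto simp: mixed_stable_def)
  have "T \<noteq> Leaf" using \<open>X \<noteq> []\<close> lq by (cases X) (auto simp: leaf_queries_def leaf_key_def)
  obtain Tr es where opt_run: "valid_run X T Tr es" "opt_cost X T = run_cost X Tr es"
    by (rule opt_cost_attained)
  interpret bst_run T X Tr es by unfold_locales (use assms(1) full opt_run in auto)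
  let ?c = "\<Sum>v\<in>inner_nodes T. query_count X v"
  let ?g = "\<Sum>v\<in>inner_nodes T. card (touch_times v)"
  have gf: "gf_cost X T \<le> length X + ?c"
    using gf_cost_le[OF assms(1,3)] sum_card_path_keys[OF assms(1) full lq] by simp
  have opt: "length X + ?g \<le> opt_cost X T" using run_cost_ge[OF \<open>T \<noteq> Leaf\<close>] opt_run(2) by simp
  have "0 < length X" using \<open>X \<noteq> []\<close> by simp
  \<comment> \<open>With \<open>m\<close> for \<open>length X\<close>:
    \<open>2 * (m + ?c) \<le> 2 * m + 5 * ?g < 5 * (m + ?g)\<close>. In the strong case the slack is
    smaller: \<open>?c < 2 * ?g + m\<close> yields \<open>m + ?c < 2 * (m + ?g)\<close>.\<close>
  then have "2 * gf_cost X T < 5 * opt_cost X T"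
    using gf opt mixed_stable_sum[OF XX] by linarith
  moreover have "gf_cost X T < 2 * opt_cost X T" if "strongly_stable T X"
    using gf opt strongly_stable_sum[OF XX that \<open>X \<noteq> []\<close>] by linarith
  ultimately show ?thesis by auto
qed

end
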